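(* Let $G$ be a finitely generated metabelian group that is not virtually abelian. Then $G$ has a finitely generated subgroup isomorphic to one of the following: (1) the wreath product $\mathbb{Z} \wr \mathbb{Z}$; (2) the wreath product $C_p \wr \mathbb{Z}$ for some prime $p$; (3) a proper Gc-group.
   Context: Conventions: $x^y = y^{-1}xy$, $[x,y]=x^{-1}y^{-1}xy$; $C_p$ is the cyclic group of order $p$; $\wr$ denotes the restricted (standard) wreath product. For an integer $s \ge 1$ and $\mathbf{c} = (c_0,\ldots,c_s)\in \mathbb{Z}^{s+1}$ with $c_0 \neq 0$, $c_s\neq 0$ and $\gcd(c_0,\ldots,c_s)=1$, let $G(\mathbf{c})$ be the group defined by the presentation $\langle \alpha,\beta \mid [\beta,\beta^{\alpha^i}]\ (i\in\mathbb{Z}),\ \beta^{c_0}(\beta^{\alpha})^{c_1}\cdots(\beta^{\alpha^s})^{c_s}\rangle$. A Gc-group is a group isomorphic to some such $G(\mathbf{c})$. A proper Gc-group is a Gc-group that is not virtually abelian. *)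

theory Defs
  imports
    "HOL-Algebra.Generated_Groups"
    "HOL-Algebra.Elementary_Groups"
    "HOL-Algebra.Product_Groups"
    "HOL-Computational_Algebra.Primes"
begin

section \<open>Finiteness and commutativity conditions\<close>

definition finitely_generated :: "('a, 'b) monoid_scheme \<Rightarrow> bool" where
  "finitely_generated G \<longleftrightarrow>
     (\<exists>S. finite S \<and> S \<subseteq> carrier G \<and> generate G S = carrier G)"

definition metabelian :: "('a, 'b) monoid_scheme \<Rightarrow> bool" where
  "metabelian G \<longleftrightarrow> comm_group (G\<lparr>carrier := derived G (carrier G)\<rparr>)"

definition virtually_abelian :: "('a, 'b) monoid_scheme \<Rightarrow> bool" where
  "virtually_abelian G \<longleftrightarrow>
     (\<exists>A. subgroup A G \<and> finite (rcosets\<^bsub>G\<^esub> A) \<and> comm_group (G\<lparr>carrier := A\<rparr>))"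


section \<open>Restricted wreath products\<close>

definition semidirect_product ::
    "('a, 'c) monoid_scheme \<Rightarrow> ('b, 'd) monoid_scheme \<Rightarrow> ('b \<Rightarrow> 'a \<Rightarrow> 'a) \<Rightarrow> ('a \<times> 'b) monoid" where
  "semidirect_product N H \<phi> =
     \<lparr>carrier = carrier N \<times> carrier H,
      monoid.mult = (\<lambda>(n, h) (n', h'). (n \<otimes>\<^bsub>N\<^esub> \<phi> h n', h \<otimes>\<^bsub>H\<^esub> h')),
      one = (\<one>\<^bsub>N\<^esub>, \<one>\<^bsub>H\<^esub>)\<rparr>"

text \<open>
  The base group is the direct sum (finitely supported functions) of copies of \<open>A\<close>
  indexed by the elements of \<open>B\<close>, on which \<open>B\<close> acts by translating the index.
\<close>

definition wreath_shift ::
    "('b, 'd) monoid_scheme \<Rightarrow> 'b \<Rightarrow> ('b \<Rightarrow> 'a) \<Rightarrow> 'b \<Rightarrow> 'a" where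
  "wreath_shift B b f = (\<lambda>x\<in>carrier B. f (inv\<^bsub>B\<^esub> b \<otimes>\<^bsub>B\<^esub> x))"

definition wreath_product ::
    "('a, 'c) monoid_scheme \<Rightarrow> ('b, 'd) monoid_scheme \<Rightarrow> (('b \<Rightarrow> 'a) \<times> 'b) monoid" where
  "wreath_product A B =
     semidirect_product (sum_group (carrier B) (\<lambda>_. A)) B (wreath_shift B)"

lemma group_semidirect_product:
  assumes "group N" "group H"
    and hom: "\<And>h. h \<in> carrier H \<Longrightarrow> \<phi> h \<in> hom N N"
    and one: "\<And>n. n \<in> carrier N \<Longrightarrow> \<phi> \<one>\<^bsub>H\<^esub> n = n"
    and mult: "\<And>h k n. \<lbrakk>h \<in> carrier H; k \<in> carrier H; n \<in> carrier N\<rbrakk>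
                 \<Longrightarrow> \<phi> (h \<otimes>\<^bsub>H\<^esub> k) n = \<phi> h (\<phi> k n)"
  shows "group (semidirect_product N H \<phi>)"
proof -
  interpret N: group N by fact
  interpret H: group H by fact
  have clo: "\<phi> h n \<in> carrier N" if "h \<in> carrier H" "n \<in> carrier N" for h n
    using hom[OF that(1)] that(2) by (auto simp: hom_def)
  have mul: "\<phi> h (n \<otimes>\<^bsub>N\<^esub> m) = \<phi> h n \<otimes>\<^bsub>N\<^esub> \<phi> h m"
    if "h \<in> carrier H" "n \<in> carrier N" "m \<in> carrier N" for h n m
    using hom[OF that(1)] that by (auto simp: hom_def)
  show ?thesis
  proof (rule groupI)
    fix x assume "x \<in> carrier (semidirect_product N H \<phi>)"
    then obtain n h where x: "x = (n, h)" and nh: "n \<in> carrier N" "h \<in> carrier H"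
      by (auto simp: semidirect_product_def)
    let ?y = "(\<phi> (inv\<^bsub>H\<^esub> h) (inv\<^bsub>N\<^esub> n), inv\<^bsub>H\<^esub> h)"
    have "\<phi> (inv\<^bsub>H\<^esub> h) (inv\<^bsub>N\<^esub> n) \<otimes>\<^bsub>N\<^esub> \<phi> (inv\<^bsub>H\<^esub> h) n = \<one>\<^bsub>N\<^esub>"
      using nh mul[of "inv\<^bsub>H\<^esub> h" "inv\<^bsub>N\<^esub> n" n] hom_one[OF hom[of "inv\<^bsub>H\<^esub> h"]] assms(1)
      by simp
    then show "\<exists>y\<in>carrier (semidirect_product N H \<phi>).
        y \<otimes>\<^bsub>semidirect_product N H \<phi>\<^esub> x = \<one>\<^bsub>semidirect_product N H \<phi>\<^esub>"
      using nh clo by (intro bexI[of _ ?y]) (auto simp: semidirect_product_def x)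
  qed (auto simp: semidirect_product_def clo mul one mult N.m_assoc H.m_assoc)
qed

lemma group_wreath_product:
  assumes "group A" "group B"
  shows "group (wreath_product A B)"
proof -
  interpret A: group A by fact
  interpret B: group B by fact
  let ?S = "sum_group (carrier B) (\<lambda>_. A)"
  have carr: "carrier ?S = {f \<in> carrier B \<rightarrow>\<^sub>E carrier A. finite {x \<in> carrier B. f x \<noteq> \<one>\<^bsub>A\<^esub>}}"
    by (rule carrier_sum_group) (rule assms(1))
  have shift: "wreath_shift B b f \<in> carrier ?S" if b: "b \<in> carrier B" and f: "f \<in> carrier ?S" for b f
  proof -
    have "{x \<in> carrier B. wreath_shift B b f x \<noteq> \<one>\<^bsub>A\<^esub>}
        \<subseteq> (\<lambda>x. b \<otimes>\<^bsub>B\<^esub> x) ` {x \<in> carrier B. f x \<noteq> \<one>\<^bsub>A\<^esub>}"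
    proof
      fix x assume x: "x \<in> {x \<in> carrier B. wreath_shift B b f x \<noteq> \<one>\<^bsub>A\<^esub>}"
      then show "x \<in> (\<lambda>x. b \<otimes>\<^bsub>B\<^esub> x) ` {x \<in> carrier B. f x \<noteq> \<one>\<^bsub>A\<^esub>}"
        using b by (intro image_eqI[of _ _ "inv\<^bsub>B\<^esub> b \<otimes>\<^bsub>B\<^esub> x"])
          (auto simp: wreath_shift_def B.m_assoc[symmetric])
    qed
    moreover have "finite {x \<in> carrier B. f x \<noteq> \<one>\<^bsub>A\<^esub>}"
      using f by (simp add: carr)
    ultimately have "finite {x \<in> carrier B. wreath_shift B b f x \<noteq> \<one>\<^bsub>A\<^esub>}"
      by (meson finite_imageI finite_subset)
    moreover have "wreath_shift B b f \<in> carrier B \<rightarrow>\<^sub>E carrier A"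
      using f b by (auto simp: carr wreath_shift_def)
    ultimately show ?thesis by (simp add: carr)
  qed
  show ?thesis
    unfolding wreath_product_def
  proof (rule group_semidirect_product)
    show "group ?S" by (simp add: assms(1))
    show "group B" by fact
    show "wreath_shift B b \<in> hom ?S ?S" if "b \<in> carrier B" for b
      using that shift by (intro homI) (auto simp: wreath_shift_def fun_eq_iff)
    show "wreath_shift B \<one>\<^bsub>B\<^esub> f = f" if "f \<in> carrier ?S" for f
      using that by (auto simp: carr wreath_shift_def PiE_def extensional_def fun_eq_iff)
    show "wreath_shift B (b \<otimes>\<^bsub>B\<^esub> c) f = wreath_shift B b (wreath_shift B c f)"
      if "b \<in> carrier B" "c \<in> carrier B" for b c and f :: "'c \<Rightarrow> 'a"
      using that by (auto simp: wreath_shift_def fun_eq_iff B.inv_mult_group B.m_assoc)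
  qed
qed


section \<open>Group presentations\<close>

text \<open>
  A letter \<open>(x, True)\<close> stands for the generator \<open>x\<close>, a letter \<open>(x, False)\<close> for its inverse.
\<close>

inductive free_cancel :: "('x \<times> bool) list \<Rightarrow> ('x \<times> bool) list \<Rightarrow> bool" where
  "free_cancel (u @ (x, b) # (x, \<not> b) # v) (u @ v)"

definition free_rel :: "(('x \<times> bool) list \<times> ('x \<times> bool) list) set" where
  "free_rel = {(u, v). equivclp free_cancel u v}"

text \<open>The free group on all elements of the type \<open>'x\<close>.\<close>

definition free_group :: "('x \<times> bool) list set monoid" where
  "free_group =
     \<lparr>carrier = UNIV // free_rel,
      monoid.mult = (\<lambda>U V. \<Union>u\<in>U. \<Union>v\<in>V. free_rel `` {u @ v}),
      one = free_rel `` {[]}\<rparr>"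

definition free_gen :: "'x \<Rightarrow> ('x \<times> bool) list set" where
  "free_gen x = free_rel `` {[(x, True)]}"

definition normal_closure :: "('a, 'b) monoid_scheme \<Rightarrow> 'a set \<Rightarrow> 'a set" where
  "normal_closure G R = \<Inter> {N. N \<lhd> G \<and> R \<subseteq> N}"

definition presented_group ::
    "('x \<times> bool) list set set \<Rightarrow> ('x \<times> bool) list set set monoid" where
  "presented_group R = free_group Mod (normal_closure free_group R)"

lemma equiv_free_rel: "equiv UNIV free_rel"
  unfolding free_rel_def by (rule equivI)
    (auto simp: refl_on_def sym_def trans_def intro: equivclp_sym equivclp_trans)

lemma free_rel_append:
  assumes "(u, u') \<in> free_rel" "(v, v') \<in> free_rel"
  shows "(u @ v, u' @ v') \<in> free_rel"
proof -
  have step: "free_cancel (a @ x @ b) (a @ y @ b)" if "free_cancel x y" for a b x y :: "('x \<times> bool) list"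
    using that
  proof cases
    case (1 p z c q)
    then show ?thesis using free_cancel.intros[of "a @ p" z c "q @ b"] by simp
  qed
  have ctxt: "equivclp free_cancel (a @ x @ b) (a @ y @ b)" if "equivclp free_cancel x y"
    for a b x y :: "('x \<times> bool) list"
    using that
  proof (induction rule: equivclp_induct)
    case base
    then show ?case by simp
  next
    case (step y z)
    then have "free_cancel (a @ y @ b) (a @ z @ b) \<or> free_cancel (a @ z @ b) (a @ y @ b)"
      using \<open>\<And>y x b a. free_cancel x y \<Longrightarrow> free_cancel (a @ x @ b) (a @ y @ b)\<close> by blast
    then show ?case using step.IH by (meson equivclp_into_equivclp)
  qed
  have "equivclp free_cancel (u @ v) (u' @ v)"
    using assms(1) ctxt[of u u' "[]" v] by (simp add: free_rel_def)
  moreover have "equivclp free_cancel (u' @ v) (u' @ v')"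
    using assms(2) ctxt[of v v' "u'" "[]"] by (simp add: free_rel_def)
  ultimately show ?thesis by (auto simp: free_rel_def intro: equivclp_trans)
qed

lemma carrier_free_group: "carrier free_group = range (\<lambda>u. free_rel `` {u})"
  by (auto simp: free_group_def quotient_def)

lemma one_free_group: "\<one>\<^bsub>free_group\<^esub> = free_rel `` {[]}"
  by (simp add: free_group_def)

lemma mult_free_group:
  "free_rel `` {u} \<otimes>\<^bsub>free_group\<^esub> free_rel `` {v} = free_rel `` {u @ v}"
proof -
  have "free_rel `` {a @ b} = free_rel `` {u @ v}"
    if "a \<in> free_rel `` {u}" "b \<in> free_rel `` {v}" for a b
  proof -
    have "(u @ v, a @ b) \<in> free_rel" using that by (intro free_rel_append) auto
    then show ?thesis using equiv_class_eq[OF equiv_free_rel] by metis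
  qed
  moreover have "u \<in> free_rel `` {u}" "v \<in> free_rel `` {v}"
    using equiv_class_self[OF equiv_free_rel] by auto
  ultimately have "(\<Union>a\<in>free_rel `` {u}. \<Union>b\<in>free_rel `` {v}. free_rel `` {a @ b})
      = free_rel `` {u @ v}" by blast
  then show ?thesis by (simp add: free_group_def)
qed

lemma free_rel_inverse:
  "(rev (map (\<lambda>(x, b). (x, \<not> b)) w) @ w, []) \<in> free_rel"
proof (induction w)
  case Nil
  show ?case by (simp add: free_rel_def)
next
  case (Cons l w)
  obtain x b where l: "l = (x, b)" by (cases l)
  let ?w = "rev (map (\<lambda>(x, b). (x, \<not> b)) w)"
  have "free_cancel (?w @ (x, \<not> b) # (x, \<not> \<not> b) # w) (?w @ w)"
    by (rule free_cancel.intros)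
  then have "(?w @ (x, \<not> b) # (x, b) # w, ?w @ w) \<in> free_rel"
    by (auto simp: free_rel_def)
  then have "(?w @ (x, \<not> b) # (x, b) # w, []) \<in> free_rel"
    using Cons.IH equiv_free_rel by (meson equivE transD)
  then show ?case by (simp add: l)
qed

lemma group_free_group: "group free_group"
proof (rule groupI)
  fix U :: "('x \<times> bool) list set" assume "U \<in> carrier free_group"
  then obtain u where U: "U = free_rel `` {u}" by (auto simp: carrier_free_group)
  let ?V = "free_rel `` {rev (map (\<lambda>(x, b). (x, \<not> b)) u)}"
  have "?V \<otimes>\<^bsub>free_group\<^esub> U = \<one>\<^bsub>free_group\<^esub>"
    unfolding U mult_free_group one_free_group
    by (rule equiv_class_eq[OF equiv_free_rel free_rel_inverse])
  then show "\<exists>V\<in>carrier free_group. V \<otimes>\<^bsub>free_group\<^esub> U = \<one>\<^bsub>free_group\<^esub>"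
    by (auto simp: carrier_free_group)
qed (auto simp: carrier_free_group one_free_group mult_free_group)

lemma (in group) normal_normal_closure:
  assumes "R \<subseteq> carrier G"
  shows "normal_closure G R \<lhd> G"
proof -
  let ?F = "{N. N \<lhd> G \<and> R \<subseteq> N}"
  have "carrier G \<lhd> G" by (simp add: normal_inv_iff subgroup_self)
  then have ne: "?F \<noteq> {}" using assms by auto
  have "subgroup (\<Inter> ?F) G"
    using ne by (intro subgroups_Inter) (auto simp: normal_imp_subgroup)
  then show ?thesis
    unfolding normal_closure_def normal_inv_iff by auto
qed

lemma group_presented_group:
  assumes "R \<subseteq> carrier free_group"
  shows "group (presented_group R)"
  unfolding presented_group_def
  by (rule normal.factorgroup_is_group[OF group.normal_normal_closure[OF group_free_group assms]])


section \<open>Gc-groups\<close>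

definition grp_conjugate :: "('a, 'b) monoid_scheme \<Rightarrow> 'a \<Rightarrow> 'a \<Rightarrow> 'a" where
  "grp_conjugate G x y = inv\<^bsub>G\<^esub> y \<otimes>\<^bsub>G\<^esub> x \<otimes>\<^bsub>G\<^esub> y"

definition grp_commutator :: "('a, 'b) monoid_scheme \<Rightarrow> 'a \<Rightarrow> 'a \<Rightarrow> 'a" where
  "grp_commutator G x y = inv\<^bsub>G\<^esub> x \<otimes>\<^bsub>G\<^esub> inv\<^bsub>G\<^esub> y \<otimes>\<^bsub>G\<^esub> x \<otimes>\<^bsub>G\<^esub> y"

datatype Gc_gen = Alpha | Beta

abbreviation (input) Gc_alpha :: "(Gc_gen \<times> bool) list set" where
  "Gc_alpha \<equiv> free_gen Alpha"

abbreviation (input) Gc_beta :: "(Gc_gen \<times> bool) list set" where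
  "Gc_beta \<equiv> free_gen Beta"

text \<open>
  The tuple \<open>(c\<^sub>0, \<dots>, c\<^sub>s)\<close> is represented by \<open>s\<close> and a function \<open>c\<close>
  of which only the values at \<open>0, \<dots>, s\<close> are used.
\<close>

definition Gc_relators :: "nat \<Rightarrow> (nat \<Rightarrow> int) \<Rightarrow> (Gc_gen \<times> bool) list set set" where
  "Gc_relators s c =
     {grp_commutator free_group Gc_beta
        (grp_conjugate free_group Gc_beta (Gc_alpha [^]\<^bsub>free_group\<^esub> i)) | i :: int. True} \<union>
     {foldr (\<otimes>\<^bsub>free_group\<^esub>)
        (map (\<lambda>i. grp_conjugate free_group Gc_beta (Gc_alpha [^]\<^bsub>free_group\<^esub> i)
                    [^]\<^bsub>free_group\<^esub> c i) [0..<Suc s])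
        \<one>\<^bsub>free_group\<^esub>}"

definition Gc_presented :: "nat \<Rightarrow> (nat \<Rightarrow> int) \<Rightarrow> (Gc_gen \<times> bool) list set set monoid" where
  "Gc_presented s c = presented_group (Gc_relators s c)"

definition Gc_admissible :: "nat \<Rightarrow> (nat \<Rightarrow> int) \<Rightarrow> bool" where
  "Gc_admissible s c \<longleftrightarrow> s \<ge> 1 \<and> c 0 \<noteq> 0 \<and> c s \<noteq> 0 \<and> Gcd (c ` {0..s}) = 1"

definition Gc_group :: "('a, 'b) monoid_scheme \<Rightarrow> bool" where
  "Gc_group H \<longleftrightarrow> group H \<and> (\<exists>s c. Gc_admissible s c \<and> H \<cong> Gc_presented s c)"

definition proper_Gc_group :: "('a, 'b) monoid_scheme \<Rightarrow> bool" where
  "proper_Gc_group H \<longleftrightarrow> Gc_group H \<and> \<not> virtually_abelian H"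

lemma Gc_relators_carrier: "Gc_relators s c \<subseteq> carrier free_group"
proof -
  interpret F: group "free_group :: (Gc_gen \<times> bool) list set monoid" by (rule group_free_group)
  have gen: "free_gen x \<in> carrier free_group" for x :: Gc_gen
    by (simp add: free_gen_def carrier_free_group)
  have foldr_closed: "foldr (\<otimes>\<^bsub>free_group\<^esub>) ws \<one>\<^bsub>free_group\<^esub> \<in> carrier free_group"
    if "set ws \<subseteq> carrier free_group" for ws :: "(Gc_gen \<times> bool) list set list"
    using that by (induction ws) auto
  show ?thesis
    unfolding Gc_relators_def grp_commutator_def grp_conjugate_def
    by (auto simp: gen simp del: upt_Suc foldr_map intro!: foldr_closed)
qed

lemma group_Gc_presented: "group (Gc_presented s c)"
  unfolding Gc_presented_def by (rule group_presented_group[OF Gc_relators_carrier])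

end

theory Submission
  imports
    Defs
    "HOL-Algebra.FiniteProduct"
    "HOL-Computational_Algebra.Polynomial"
begin

text \<open>
  Call \<open>(a, g)\<close> a free pair if the conjugates \<open>a\<^sub>i\<close> of \<open>a\<close> by \<open>g\<^sup>i\<close> commute with one another and
  no power \<open>g\<^sup>m\<close> with \<open>m > 0\<close> commutes with \<open>a\<close>. If there were no free pair in \<open>G\<close>, suitable powers
  of the generators would centralise the derived subgroup, then suitable powers of these would
  commute with one another, and together with the derived subgroup they would generate an
  abelian normal subgroup with a finitely generated abelian torsion quotient, hence of finite index.

  For a free pair \<open>(a, g)\<close>, the subgroup \<open>N\<close> generated by the \<open>a\<^sub>i\<close> is a cyclic module over the ring of integral
  Laurent polynomials and meets the powers of \<open>g\<close> trivially. If some free pair \<open>(u, g)\<close> has \<open>u\<close> of prime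
  order \<open>p\<close>, then \<open>u\<close> and \<open>g\<close> generate \<open>C\<^sub>p wr \<int>\<close>, since a relation would bound the dimension over
  the field with \<open>p\<close> elements and so make the orbit of \<open>u\<close> finite. Otherwise all pairs \<open>(a\<^sup>d, g)\<close> with
  \<open>d > 0\<close> are free. Either \<open>a\<close> has zero annihilator and we obtain \<open>\<int> wr \<int>\<close>, or we
  choose a nonzero polynomial \<open>p\<close> of least degree annihilating \<open>a\<close>. With \<open>d\<close> the content of \<open>p\<close>,
  pseudo-division and Gauss's lemma show that the annihilator of \<open>a\<^sup>d\<close> is generated by the primitive
  part of \<open>p\<close>, so that \<open>a\<^sup>d\<close> and \<open>g\<close> generate the Gc-group of its coefficients.
\<close>

section \<open>Free pairs in metabelian groups\<close>

text \<open>Each condition is inherited by multiples of its exponent, so the product of the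
  individual exponents serves every member of the finite set.\<close>

lemma common_exponent:
  assumes "finite F" "\<And>f. f \<in> F \<Longrightarrow> \<exists>m>0. P f (m::nat)"
    and mult: "\<And>f m k. \<lbrakk>f \<in> F; P f m\<rbrakk> \<Longrightarrow> P f (m * k)"
  shows "\<exists>m>0. \<forall>f\<in>F. P f m"
  using assms
proof (induction F rule: finite_induct)
  case empty
  then show ?case by auto
next
  case (insert x F)
  have "\<exists>m>0. \<forall>f\<in>F. P f m" using insert.prems by (intro insert.IH) auto
  then obtain m where m: "m > 0" "\<forall>f\<in>F. P f m" by blast
  obtain k where k: "k > 0" "P x k" using insert.prems(1)[of x] by auto
  have "P f (m * k)" if "f \<in> insert x F" for f
    using that insert.prems(2)[of x k m] insert.prems(2)[of f m k] m k by (auto simp: mult.commute)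
  then show ?case using m k by (intro exI[of _ "m * k"]) auto
qed

section \<open>Centralisers and subgroups generated by commuting elements\<close>

context group
begin

lemma inv_cancel [simp]:
  assumes "x \<in> carrier G" "y \<in> carrier G"
  shows "inv x \<otimes> (x \<otimes> y) = y" "x \<otimes> (inv x \<otimes> y) = y"
  using assms by (simp_all flip: m_assoc)

lemma subgroup_centralizer:
  assumes "S \<subseteq> carrier G"
  shows "subgroup {x \<in> carrier G. \<forall>s\<in>S. x \<otimes> s = s \<otimes> x} G"
proof (rule subgroupI)
  fix x y assume *: "x \<in> {x \<in> carrier G. \<forall>s\<in>S. x \<otimes> s = s \<otimes> x}"
    "y \<in> {x \<in> carrier G. \<forall>s\<in>S. x \<otimes> s = s \<otimes> x}"
  have "inv x \<otimes> s = s \<otimes> inv x" if "s \<in> S" for s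
  proof -
    have s: "s \<in> carrier G" "x \<in> carrier G" using that assms * by auto
    have "inv x \<otimes> s = inv x \<otimes> (s \<otimes> x) \<otimes> inv x" using s by (simp add: m_assoc)
    also have "s \<otimes> x = x \<otimes> s" using * that by auto
    finally show ?thesis using s by (simp add: m_assoc)
  qed
  then show "inv x \<in> {x \<in> carrier G. \<forall>s\<in>S. x \<otimes> s = s \<otimes> x}" using * by auto
  have "x \<otimes> y \<otimes> s = s \<otimes> (x \<otimes> y)" if "s \<in> S" for s
  proof -
    have s: "s \<in> carrier G" "x \<in> carrier G" "y \<in> carrier G" using that assms * by auto
    have "x \<otimes> y \<otimes> s = x \<otimes> (s \<otimes> y)" using s * that by (simp add: m_assoc)
    also have "\<dots> = x \<otimes> s \<otimes> y" using s by (simp add: m_assoc)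
    also have "\<dots> = s \<otimes> x \<otimes> y" using * that by simp
    finally show ?thesis using s by (simp add: m_assoc)
  qed
  then show "x \<otimes> y \<in> {x \<in> carrier G. \<forall>s\<in>S. x \<otimes> s = s \<otimes> x}" using * by auto
next
  have "\<one> \<in> {x \<in> carrier G. \<forall>s\<in>S. x \<otimes> s = s \<otimes> x}" using assms by auto
  then show "{x \<in> carrier G. \<forall>s\<in>S. x \<otimes> s = s \<otimes> x} \<noteq> {}" by blast
qed auto

lemma generate_commute:
  assumes "S \<subseteq> carrier G" "y \<in> carrier G" "\<And>s. s \<in> S \<Longrightarrow> y \<otimes> s = s \<otimes> y" "x \<in> generate G S"
  shows "y \<otimes> x = x \<otimes> y"
proof -
  have "S \<subseteq> {x \<in> carrier G. \<forall>s\<in>{y}. x \<otimes> s = s \<otimes> x}" using assms by auto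
  then have "generate G S \<subseteq> {x \<in> carrier G. \<forall>s\<in>{y}. x \<otimes> s = s \<otimes> x}"
    using assms(2) by (intro generate_subgroup_incl subgroup_centralizer) auto
  then show ?thesis using assms(4) by auto
qed

lemma comm_group_generate:
  assumes S: "S \<subseteq> carrier G" and comm: "\<And>x y. \<lbrakk>x \<in> S; y \<in> S\<rbrakk> \<Longrightarrow> x \<otimes> y = y \<otimes> x"
  shows "comm_group (G\<lparr>carrier := generate G S\<rparr>)"
proof (rule group.group_comm_groupI)
  show "group (G\<lparr>carrier := generate G S\<rparr>)"
    by (rule subgroup_imp_group[OF generate_is_subgroup[OF S]])
  fix x y assume "x \<in> carrier (G\<lparr>carrier := generate G S\<rparr>)" "y \<in> carrier (G\<lparr>carrier := generate G S\<rparr>)"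
  then have xy: "x \<in> generate G S" "y \<in> generate G S" by auto
  have "x \<otimes> s = s \<otimes> x" if "s \<in> S" for s
    using generate_commute[OF S, of s x] S comm that xy by (metis subsetD)
  then show "x \<otimes>\<^bsub>G\<lparr>carrier := generate G S\<rparr>\<^esub> y = y \<otimes>\<^bsub>G\<lparr>carrier := generate G S\<rparr>\<^esub> x"
    using generate_commute[OF S, of x y] xy generate_in_carrier[OF S] by auto
qed

lemma commute_pow:
  assumes "x \<in> carrier G" "y \<in> carrier G" "x \<otimes> y = y \<otimes> x"
  shows "x [^] (n::nat) \<otimes> y = y \<otimes> x [^] n"
proof (induction n)
  case (Suc n)
  have "x [^] Suc n \<otimes> y = x [^] n \<otimes> y \<otimes> x" using assms by (simp add: m_assoc)
  also have "\<dots> = y \<otimes> x [^] Suc n" using Suc assms by (simp add: m_assoc)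
  finally show ?case .
qed (use assms in simp)

end

text \<open>Induction on \<open>S\<close>: if \<open>s [^] n = \<one>\<close>, commutativity lets
  every element of the enlarged subgroup be written as a power of \<open>s\<close> with exponent
  below \<open>n\<close> times an element of the old subgroup.\<close>

lemma (in comm_group) finite_generate_torsion:
  assumes "finite S" "S \<subseteq> carrier G" "\<And>s. s \<in> S \<Longrightarrow> \<exists>n>0. s [^] (n::nat) = \<one>"
  shows "finite (generate G S)"
  using assms
proof (induction S rule: finite_induct)
  case empty
  then show ?case by (simp add: generate_empty)
next
  case (insert s S)
  then obtain n :: nat where n: "n > 0" "s [^] n = \<one>" by auto
  have s: "s \<in> carrier G" and S: "S \<subseteq> carrier G" using insert.prems by auto
  note Sc = generate_in_carrier[OF S]
  let ?T = "(\<lambda>(i, y). s [^] i \<otimes> y) ` ({..<n} \<times> generate G S)"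
  have T: "s [^] i \<otimes> y \<in> ?T" if "y \<in> generate G S" for i :: nat and y
  proof -
    have "s [^] i = s [^] (n * (i div n) + i mod n)" by simp
    also have "\<dots> = (s [^] n) [^] (i div n) \<otimes> s [^] (i mod n)"
      using s by (simp add: nat_pow_mult nat_pow_pow del: mult_div_mod_eq)
    finally have "s [^] i = s [^] (i mod n)" using s n by simp
    then show ?thesis using that n by (intro image_eqI[of _ _ "(i mod n, y)"]) auto
  qed
  have "x \<in> ?T" if "x \<in> generate G (insert s S)" for x
    using that
  proof (induction rule: generate.induct)
    case one
    show ?case using T[of \<one> 0] by (simp add: generate.one)
  next
    case (incl h)
    then show ?case
      using T[OF generate.one, of 1] T[of h 0] s S
      by (cases "h = s") (simp_all add: generate.incl subsetD)
  next
    case (inv h)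
    show ?case
    proof (cases "h = s")
      case True
      have "s [^] (n - 1) \<otimes> s = \<one>" using n s by (metis Suc_pred' nat_pow_Suc)
      then have "inv s = s [^] (n - 1)" using s by (metis inv_equality nat_pow_closed)
      then show ?thesis using T[of \<one> "n - 1"] True s by (simp add: generate.one)
    next
      case False
      then show ?thesis using T[of "inv h" 0] inv S Sc by (auto simp: generate.inv subsetD)
    qed
  next
    case (eng x y)
    then obtain i j u v where "x = s [^] (i::nat) \<otimes> u" "y = s [^] (j::nat) \<otimes> v"
      "u \<in> generate G S" "v \<in> generate G S" by auto
    moreover from this have "x \<otimes> y = s [^] (i + j) \<otimes> (u \<otimes> v)"
      using s Sc by (simp add: m_ac flip: nat_pow_mult)
    ultimately show ?case using T[of "u \<otimes> v" "i + j"] by (simp add: generate.eng)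
  qed
  then have "generate G (insert s S) \<subseteq> ?T" by blast
  moreover have "finite (generate G S)" using insert.prems by (intro insert.IH) auto
  ultimately show ?case by (elim finite_subset) simp
qed

lemma (in normal) rcos_commute:
  assumes xy: "x \<in> carrier G" "y \<in> carrier G" and "x \<otimes> y \<otimes> inv x \<otimes> inv y \<in> H"
  shows "(H #> x) \<otimes>\<^bsub>G Mod H\<^esub> (H #> y) = (H #> y) \<otimes>\<^bsub>G Mod H\<^esub> (H #> x)"
proof -
  have "x \<otimes> y \<otimes> inv (y \<otimes> x) \<in> H"
    using assms by (simp add: inv_mult_group m_assoc)
  then have "x \<otimes> y \<in> H #> (y \<otimes> x)"
    using xy rcos_module_rev[OF is_group] by simp
  then have "H #> (x \<otimes> y) = H #> (y \<otimes> x)"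
    using xy repr_independence subgroup_axioms by (metis m_closed)
  then show ?thesis using xy by (simp add: rcos_sum)
qed

section \<open>Existence of a free pair\<close>

context group
begin

text \<open>The quotient by \<open>D\<close> is generated by the images of \<open>S\<close>, which
  commute, so it is abelian. A claim on the whole derived subgroup is thereby reduced to commutators
  of generators.\<close>

lemma derived_subset_generators:
  assumes S: "S \<subseteq> carrier G" "generate G S = carrier G" and D: "D \<lhd> G"
    and comm: "\<And>x y. \<lbrakk>x \<in> S; y \<in> S\<rbrakk> \<Longrightarrow> x \<otimes> y \<otimes> inv x \<otimes> inv y \<in> D"
  shows "derived G (carrier G) \<subseteq> D"
proof (rule derived_minimal[OF D])
  interpret D: normal D G by fact
  interpret Q: group "G Mod D" by (rule D.factorgroup_is_group)
  interpret h: group_hom G "G Mod D" "(#>) D"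
    by unfold_locales (rule D.r_coset_hom_Mod)
  have "(D #> x) \<otimes>\<^bsub>G Mod D\<^esub> (D #> y) = (D #> y) \<otimes>\<^bsub>G Mod D\<^esub> (D #> x)" if "x \<in> S" "y \<in> S" for x y
  proof -
    show ?thesis using that S comm by (intro D.rcos_commute) auto
  qed
  then have "comm_group ((G Mod D)\<lparr>carrier := generate (G Mod D) ((#>) D ` S)\<rparr>)"
    using S by (intro Q.comm_group_generate) auto
  moreover have "generate (G Mod D) ((#>) D ` S) = carrier (G Mod D)"
    using S by (simp add: h.generate_img carrier_FactGroup)
  ultimately show "comm_group (G Mod D)" by simp
qed

text \<open>Hypothesis \<open>orb\<close> says that there is no free pair. It yields one exponent
  \<open>m\<close> for the finitely many commutators of generators. The elements of the derived
  subgroup that commute with all \<open>s [^] m\<close> form a normal subgroup, so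
  \<open>derived_subset_generators\<close> applies to it.\<close>

lemma metabelian_exponent:
  assumes fg: "finite S" "S \<subseteq> carrier G" "generate G S = carrier G"
    and met: "metabelian G"
    and orb: "\<And>a g. \<lbrakk>a \<in> carrier G; g \<in> carrier G;
        \<And>i::int. a \<otimes> grp_conjugate G a (g [^] i) = grp_conjugate G a (g [^] i) \<otimes> a\<rbrakk>
        \<Longrightarrow> \<exists>m>0. g [^] (m::nat) \<otimes> a = a \<otimes> g [^] m"
  shows "\<exists>m>0. \<forall>s\<in>S. \<forall>x\<in>derived G (carrier G). s [^] (m::nat) \<otimes> x = x \<otimes> s [^] m"
proof -
  let ?A = "derived G (carrier G)"
  have A: "?A \<lhd> G" by (rule derived_self_is_normal)
  interpret A: normal ?A G by fact
  have comm: "x \<otimes> y = y \<otimes> x" if "x \<in> ?A" "y \<in> ?A" for x y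
    using comm_groupE(4)[OF met[unfolded metabelian_def]] that by simp
  have comm_in: "x \<otimes> y \<otimes> inv x \<otimes> inv y \<in> ?A" if "x \<in> carrier G" "y \<in> carrier G" for x y
    unfolding derived_def by (rule generate.incl) (use that in blast)
  have conj_in: "inv y \<otimes> x \<otimes> y \<in> ?A" if "x \<in> ?A" "y \<in> carrier G" for x y
    using A.inv_op_closed1 that by simp
  let ?C = "(\<lambda>(x, y). x \<otimes> y \<otimes> inv x \<otimes> inv y) ` (S \<times> S)"
  have C: "?C \<subseteq> ?A" using comm_in fg(2) by auto
  have "\<exists>m>0. \<forall>(s, x)\<in>S \<times> ?C. s [^] (m::nat) \<otimes> x = x \<otimes> s [^] m"
  proof (rule common_exponent)
    show "finite (S \<times> ?C)" using fg by blast
    fix f assume f: "f \<in> S \<times> ?C"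
    obtain s x where sx: "f = (s, x)" by (cases f)
    have s: "s \<in> carrier G" "x \<in> ?A" "x \<in> carrier G"
      using f sx C fg(2) A.subset by auto
    have "\<exists>m>0. s [^] (m::nat) \<otimes> x = x \<otimes> s [^] m"
    proof (rule orb)
      \<comment> \<open>The derived subgroup is normal and abelian, so \<open>x\<close> commutes
        with all its conjugates.\<close>
      show "x \<otimes> grp_conjugate G x (s [^] i) = grp_conjugate G x (s [^] i) \<otimes> x" for i :: int
        using s by (intro comm) (auto simp: grp_conjugate_def intro!: conj_in)
    qed (use s in auto)
    then show "\<exists>m>0. case f of (s, x) \<Rightarrow> s [^] (m::nat) \<otimes> x = x \<otimes> s [^] m" using sx by simp
    show "case f of (s, x) \<Rightarrow> s [^] (m * k) \<otimes> x = x \<otimes> s [^] (m * k)"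
      if "case f of (s, x) \<Rightarrow> s [^] m \<otimes> x = x \<otimes> s [^] m" for m k :: nat
      using that commute_pow[of "s [^] m" x k] s by (simp add: sx nat_pow_pow)
  qed
  then obtain m where m: "m > (0::nat)"
    "\<forall>(s, x)\<in>S \<times> ?C. s [^] m \<otimes> x = x \<otimes> s [^] m" by (elim exE conjE)
  have mC: "s [^] m \<otimes> x = x \<otimes> s [^] m" if "s \<in> S" "x \<in> ?C" for s x
    using bspec[OF m(2), of "(s, x)"] that by simp
  have "?A \<subseteq> {x \<in> ?A. \<forall>s\<in>S. s [^] m \<otimes> x = x \<otimes> s [^] m}" (is "_ \<subseteq> ?D")
  proof (rule derived_subset_generators[OF fg(2,3)])
    let ?Z = "{x \<in> carrier G. \<forall>t\<in>(\<lambda>s. s [^] m) ` S. x \<otimes> t = t \<otimes> x}"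
    have "?A \<inter> ?Z = ?D"
    proof -
      have "(s [^] m \<otimes> x = x \<otimes> s [^] m) = (x \<otimes> s [^] m = s [^] m \<otimes> x)" for s x
        by (rule eq_commute)
      then show ?thesis using A.subset by auto
    qed
    moreover have "subgroup (?A \<inter> ?Z) G"
      using fg(2) by (intro subgroups_Inter_pair A.subgroup_axioms subgroup_centralizer) auto
    ultimately have "subgroup ?D G" by simp
    moreover have "w \<otimes> x \<otimes> inv w \<in> ?D" if x: "x \<in> ?D" and w: "w \<in> carrier G" for x w
    proof -
      have xc: "x \<in> carrier G" "x \<in> ?A" using x A.subset by auto
      have "s [^] m \<otimes> (w \<otimes> x \<otimes> inv w) = w \<otimes> x \<otimes> inv w \<otimes> s [^] m" if "s \<in> S" for s
      proof -
        define z where "z = s [^] m"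
        have z: "z \<in> carrier G" "z \<otimes> x = x \<otimes> z" using that fg(2) x by (auto simp: z_def)
        \<comment> \<open>\<open>u\<close> is the difference between \<open>z\<close> and its
          conjugate by \<open>w\<close>. It lies in the abelian derived subgroup and so commutes
          with \<open>x\<close>; hence that conjugate of \<open>z\<close> commutes with
          \<open>x\<close> as well.\<close>
        define u where "u = inv w \<otimes> z \<otimes> w \<otimes> inv z"
        have u: "u \<in> ?A" "u \<in> carrier G"
          using comm_in[of "inv w" z] z w by (auto simp: u_def)
        have "z \<otimes> (w \<otimes> x \<otimes> inv w) = w \<otimes> (u \<otimes> (z \<otimes> x)) \<otimes> inv w"
          using z(1) w xc by (simp add: u_def m_assoc)
        also have "\<dots> = w \<otimes> (u \<otimes> x) \<otimes> z \<otimes> inv w"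
          using z w xc u by (simp add: m_assoc)
        also have "\<dots> = w \<otimes> (x \<otimes> u) \<otimes> z \<otimes> inv w"
          using comm[OF u(1) xc(2)] by simp
        also have "\<dots> = w \<otimes> x \<otimes> inv w \<otimes> z"
          using z(1) w xc by (simp add: u_def m_assoc)
        finally show ?thesis by (simp add: z_def)
      qed
      then show ?thesis using A.inv_op_closed2[OF w xc(2)] by auto
    qed
    ultimately show "?D \<lhd> G" by (rule normal_invI)
    show "x \<otimes> y \<otimes> inv x \<otimes> inv y \<in> ?D" if "x \<in> S" "y \<in> S" for x y
    proof -
      have "x \<otimes> y \<otimes> inv x \<otimes> inv y \<in> ?C" using that by auto
      then show ?thesis using C mC by blast
    qed
  qed
  then show ?thesis using m(1) by blast
qed

lemma metabelian_not_virtually_abelian_pair: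
  assumes "finitely_generated G" and met: "metabelian G" and nva: "\<not> virtually_abelian G"
  obtains a g where "a \<in> carrier G" "g \<in> carrier G"
    "\<And>i::int. a \<otimes> grp_conjugate G a (g [^] i) = grp_conjugate G a (g [^] i) \<otimes> a"
    "\<And>m::nat. m > 0 \<Longrightarrow> g [^] m \<otimes> a \<noteq> a \<otimes> g [^] m"
proof (rule ccontr)
  assume contr: "\<not> thesis"
  note pair = that
  have orb: "\<exists>m>0. g [^] (m::nat) \<otimes> a = a \<otimes> g [^] m"
    if "a \<in> carrier G" "g \<in> carrier G"
      "\<And>i::int. a \<otimes> grp_conjugate G a (g [^] i) = grp_conjugate G a (g [^] i) \<otimes> a" for a g
    using that contr pair[of a g] by blast
  let ?A = "derived G (carrier G)"
  interpret A: normal ?A G by (rule derived_self_is_normal)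
  have comm: "x \<otimes> y = y \<otimes> x" if "x \<in> ?A" "y \<in> ?A" for x y
    using comm_groupE(4)[OF met[unfolded metabelian_def]] that by simp
  obtain S where S: "finite S" "S \<subseteq> carrier G" "generate G S = carrier G"
    using assms(1) by (auto simp: finitely_generated_def)
  obtain m where m: "m > (0::nat)"
    "\<And>s x. \<lbrakk>s \<in> S; x \<in> ?A\<rbrakk> \<Longrightarrow> s [^] m \<otimes> x = x \<otimes> s [^] m"
    using metabelian_exponent[OF S met orb] by blast
  \<comment> \<open>A second use of \<open>orb\<close>: the powers \<open>s [^] m\<close> centralise
    the derived subgroup but need not commute with one another yet.\<close>
  have "\<exists>r>0. \<forall>(s, t)\<in>S \<times> S. (t [^] m) [^] (r::nat) \<otimes> s [^] m = s [^] m \<otimes> (t [^] m) [^] r"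
  proof (rule common_exponent)
    show "finite (S \<times> S)" using S by blast
    fix f assume f: "f \<in> S \<times> S"
    obtain s t where st: "f = (s, t)" by (cases f)
    have s: "s \<in> S" "t \<in> S" "s \<in> carrier G" "t \<in> carrier G" using f st S(2) by auto
    let ?x = "s [^] m" and ?y = "t [^] m"
    have "\<exists>r>0. ?y [^] (r::nat) \<otimes> ?x = ?x \<otimes> ?y [^] r"
    proof (rule orb)
      fix i :: int
      let ?z = "?y [^] i"
      have z: "?x \<in> carrier G" "?z \<in> carrier G" using s by auto
      \<comment> \<open>\<open>?u\<close> is the commutator of \<open>?x\<close> and
        \<open>?z\<close>. It lies in the derived subgroup, so \<open>?x\<close> commutes with it by
        the choice of \<open>m\<close>, and hence with the conjugate
        \<open>?x \<otimes> ?u\<close>.\<close>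
      let ?u = "inv ?x \<otimes> (inv ?z \<otimes> ?x \<otimes> ?z)"
      have "inv ?x \<otimes> inv ?z \<otimes> inv (inv ?x) \<otimes> inv (inv ?z) \<in> ?A"
        unfolding derived_def by (rule generate.incl) (use z in blast)
      then have "?x \<otimes> ?u = ?u \<otimes> ?x"
        using s z by (intro m(2)) (simp_all add: m_assoc)
      then have "?x \<otimes> (?x \<otimes> ?u) = (?x \<otimes> ?u) \<otimes> ?x"
        using z by (metis m_assoc m_closed inv_closed)
      then show "?x \<otimes> grp_conjugate G ?x ?z = grp_conjugate G ?x ?z \<otimes> ?x"
        using z by (simp add: grp_conjugate_def)
    qed (use s in auto)
    then show "\<exists>r>0. case f of (s, t) \<Rightarrow> (t [^] m) [^] (r::nat) \<otimes> s [^] m = s [^] m \<otimes> (t [^] m) [^] r"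
      using st by simp
    show "case f of (s, t) \<Rightarrow> (t [^] m) [^] (r * k) \<otimes> s [^] m = s [^] m \<otimes> (t [^] m) [^] (r * k)"
      if "case f of (s, t) \<Rightarrow> (t [^] m) [^] r \<otimes> s [^] m = s [^] m \<otimes> (t [^] m) [^] r" for r k :: nat
      using that commute_pow[of "(t [^] m) [^] r" "s [^] m" k] s by (simp add: st nat_pow_pow mult.assoc)
  qed
  then obtain r where r: "r > (0::nat)"
    "\<forall>(s, t)\<in>S \<times> S. (t [^] m) [^] r \<otimes> s [^] m = s [^] m \<otimes> (t [^] m) [^] r"
    by (elim exE conjE)
  have rS: "(t [^] m) [^] r \<otimes> s [^] m = s [^] m \<otimes> (t [^] m) [^] r" if "s \<in> S" "t \<in> S" for s t
    using bspec[OF r(2), of "(s, t)"] that by simp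
  define q where "q s = (s [^] m) [^] r" for s
  have q: "q s \<in> carrier G" if "s \<in> S" for s using that S(2) by (auto simp: q_def)
  have qA: "q s \<otimes> x = x \<otimes> q s" if "s \<in> S" "x \<in> ?A" for s x
    using commute_pow[of "s [^] m" x r] m(2)[OF that] that S(2) A.subset by (auto simp: q_def)
  have qq: "q s \<otimes> q t = q t \<otimes> q s" if "s \<in> S" "t \<in> S" for s t
    using commute_pow[of "s [^] m" "q t" r] rS[OF that] that S(2) q[OF that(2)]
    by (auto simp: q_def)
  let ?K = "generate G (?A \<union> q ` S)"
  have gens: "?A \<union> q ` S \<subseteq> carrier G" using A.subset q by auto
  have sub: "subgroup ?K G" by (rule generate_is_subgroup[OF gens])
  have com: "comm_group (G\<lparr>carrier := ?K\<rparr>)"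
    by (rule comm_group_generate[OF gens]) (auto simp: comm qA qq)
  \<comment> \<open>Containing the derived subgroup makes \<open>?K\<close> normal with abelian
    quotient. Since \<open>q s\<close> lies in \<open>?K\<close>, the images of the generators are
    torsion and the quotient is finite.\<close>
  have AK: "?A \<subseteq> ?K" using generate.incl[of _ "?A \<union> q ` S" G] by blast
  have nK: "?K \<lhd> G"
  proof (rule normal_invI[OF sub])
    fix x h assume x: "x \<in> carrier G" and h: "h \<in> ?K"
    have hc: "h \<in> carrier G" using h generate_in_carrier[OF gens] by blast
    have "x \<otimes> h \<otimes> inv x \<otimes> inv h \<in> ?A"
      unfolding derived_def by (rule generate.incl) (use x hc in blast)
    then have "x \<otimes> h \<otimes> inv x \<otimes> inv h \<otimes> h \<in> ?K" using AK h by (blast intro: generate.eng)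
    then show "x \<otimes> h \<otimes> inv x \<in> ?K" using x hc by (simp add: m_assoc)
  qed
  interpret K: normal ?K G by fact
  interpret Q: group "G Mod ?K" by (rule K.factorgroup_is_group)
  interpret h: group_hom G "G Mod ?K" "(#>) ?K"
    by unfold_locales (rule K.r_coset_hom_Mod)
  have img: "generate (G Mod ?K) ((#>) ?K ` S) = carrier (G Mod ?K)"
    using S by (simp add: h.generate_img carrier_FactGroup)
  have "comm_group ((G Mod ?K)\<lparr>carrier := generate (G Mod ?K) ((#>) ?K ` S)\<rparr>)"
  proof (rule Q.comm_group_generate)
    show "(#>) ?K ` S \<subseteq> carrier (G Mod ?K)" using S(2) by auto
    fix u v assume "u \<in> (#>) ?K ` S" "v \<in> (#>) ?K ` S"
    then obtain x y where uv: "u = ?K #> x" "v = ?K #> y" and xy: "x \<in> carrier G" "y \<in> carrier G"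
      using S(2) by auto
    have "x \<otimes> y \<otimes> inv x \<otimes> inv y \<in> ?A"
      unfolding derived_def by (rule generate.incl) (use xy in blast)
    then show "u \<otimes>\<^bsub>G Mod ?K\<^esub> v = v \<otimes>\<^bsub>G Mod ?K\<^esub> u"
      using AK xy uv K.rcos_commute by blast
  qed
  then have "comm_group (G Mod ?K)" by (simp add: img)
  have "finite (generate (G Mod ?K) ((#>) ?K ` S))"
  proof (rule comm_group.finite_generate_torsion)
    show "comm_group (G Mod ?K)" by fact
    show "finite ((#>) ?K ` S)" "(#>) ?K ` S \<subseteq> carrier (G Mod ?K)" using S by auto
    fix u assume "u \<in> (#>) ?K ` S"
    then obtain s where s: "s \<in> S" "u = ?K #> s" by blast
    then have sc: "s \<in> carrier G" using S(2) by blast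
    then have "q s = s [^] (m * r)" by (simp add: q_def nat_pow_pow)
    then have "u [^]\<^bsub>G Mod ?K\<^esub> (m * r) = ?K #> q s"
      using K.FactGroup_pow[OF sc, of "m * r"] s(2) by simp
    also have "q s \<in> ?K" using s(1) by (intro generate.incl) simp
    then have "?K #> q s = ?K" by (rule K.rcos_const[OF is_group])
    finally show "\<exists>n>0. u [^]\<^bsub>G Mod ?K\<^esub> (n::nat) = \<one>\<^bsub>G Mod ?K\<^esub>"
      using m(1) r(1) by (intro exI[of _ "m * r"]) simp
  qed
  then have "finite (carrier (G Mod ?K))" by (simp only: img)
  then have "finite (rcosets ?K)" by (simp add: FactGroup_def)
  then show False using nva sub com unfolding virtually_abelian_def by blast
qed

end


section \<open>Groups generated by an element and its commuting conjugates\<close>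

lemma hom_finprod:
  assumes "comm_group A" "comm_group B" and h: "h \<in> hom A B" and f: "f \<in> S \<rightarrow> carrier A"
  shows "h (finprod A f S) = finprod B (\<lambda>x. h (f x)) S"
proof -
  interpret A: comm_group A by fact
  interpret B: comm_group B by fact
  have h1: "h \<one>\<^bsub>A\<^esub> = \<one>\<^bsub>B\<^esub>" using hom_one[OF h] A.is_group B.is_group by simp
  show ?thesis
    using f
  proof (induction S rule: infinite_finite_induct)
    case (insert x S)
    have "h (finprod A f (insert x S)) = h (f x \<otimes>\<^bsub>A\<^esub> finprod A f S)"
      using insert by simp
    also have "\<dots> = h (f x) \<otimes>\<^bsub>B\<^esub> h (finprod A f S)"
      using insert.prems by (intro hom_mult[OF h] A.finprod_closed) auto
    also have "\<dots> = finprod B (\<lambda>x. h (f x)) (insert x S)"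
      using insert hom_in_carrier[OF h] by (subst B.finprod_insert) auto
    finally show ?case .
  qed (simp_all add: h1)
qed

text \<open>Commutation is required with \<open>a\<close> itself only: conjugating by powers of
  \<open>g\<close> gives it for any two conjugates, as \<open>b_commute\<close> shows.\<close>

locale commuting_conjugates = group G for G (structure) +
  fixes a g
  assumes a_closed [simp]: "a \<in> carrier G" and g_closed [simp]: "g \<in> carrier G"
    and conj_commute: "\<And>i::int. a \<otimes> grp_conjugate G a (g [^] i) = grp_conjugate G a (g [^] i) \<otimes> a"
begin

definition conj_by :: "int \<Rightarrow> 'a \<Rightarrow> 'a" where
  "conj_by i x = grp_conjugate G x (g [^] i)"

definition b :: "int \<Rightarrow> 'a" where
  "b i = conj_by i a"

definition N :: "'a set" where
  "N = generate G (range b)"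

abbreviation "NG \<equiv> G\<lparr>carrier := N\<rparr>"

text \<open>\<open>\<Phi> f\<close> and \<open>\<Psi> p\<close> are the images of \<open>a\<close> under the Laurent polynomial with coefficients \<open>f\<close> and under \<open>p\<close>,
  where the indeterminate acts on \<open>N\<close> as conjugation by \<open>g\<close>.\<close>

definition \<Phi> :: "(int \<Rightarrow> int) \<Rightarrow> 'a" where
  "\<Phi> f = finprod NG (\<lambda>i. b i [^] f i) {i. f i \<noteq> 0}"

lemma conj_by_eq: "conj_by i x = inv (g [^] i) \<otimes> x \<otimes> g [^] i"
  by (simp add: conj_by_def grp_conjugate_def)

lemma conj_by_closed [simp]: "x \<in> carrier G \<Longrightarrow> conj_by i x \<in> carrier G"
  by (simp add: conj_by_eq)

lemma conj_by_mult: "\<lbrakk>x \<in> carrier G; y \<in> carrier G\<rbrakk> \<Longrightarrow> conj_by i (x \<otimes> y) = conj_by i x \<otimes> conj_by i y"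
  by (simp add: conj_by_eq m_assoc)

lemma conj_by_hom: "conj_by i \<in> hom G G"
  by (rule homI) (simp_all add: conj_by_mult)

lemma conj_by_one [simp]: "conj_by i \<one> = \<one>"
  by (simp add: conj_by_eq)

lemma conj_by_inv: "x \<in> carrier G \<Longrightarrow> conj_by i (inv x) = inv (conj_by i x)"
  by (simp add: conj_by_eq inv_mult_group m_assoc)

lemma conj_by_pow: "x \<in> carrier G \<Longrightarrow> conj_by i (x [^] (n::nat)) = conj_by i x [^] n"
  using hom_nat_pow[OF conj_by_hom] is_group by blast

lemma conj_by_int_pow: "x \<in> carrier G \<Longrightarrow> conj_by i (x [^] (n::int)) = conj_by i x [^] n"
  using hom_int_pow[OF conj_by_hom] is_group by blast

lemma conj_by_0 [simp]: "x \<in> carrier G \<Longrightarrow> conj_by 0 x = x"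
  by (simp add: conj_by_eq)

lemma conj_by_conj_by: "x \<in> carrier G \<Longrightarrow> conj_by i (conj_by j x) = conj_by (i + j) x"
proof -
  assume "x \<in> carrier G"
  moreover have "g [^] (i + j) = g [^] j \<otimes> g [^] i" by (simp add: add.commute flip: int_pow_mult)
  ultimately show ?thesis by (simp add: conj_by_eq inv_mult_group m_assoc)
qed

lemma conj_by_eq_iff:
  assumes "x \<in> carrier G"
  shows "conj_by i x = x \<longleftrightarrow> g [^] i \<otimes> x = x \<otimes> g [^] i"
proof
  assume "conj_by i x = x"
  then have "g [^] i \<otimes> x = g [^] i \<otimes> conj_by i x" by simp
  then show "g [^] i \<otimes> x = x \<otimes> g [^] i" using assms by (simp add: conj_by_eq m_assoc)
next
  assume "g [^] i \<otimes> x = x \<otimes> g [^] i"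
  then have "conj_by i x = inv (g [^] i) \<otimes> (g [^] i \<otimes> x)" using assms by (simp add: conj_by_eq m_assoc)
  then show "conj_by i x = x" using assms by simp
qed

lemma b_closed [simp]: "b i \<in> carrier G"
  by (simp add: b_def)

lemma conj_by_b: "conj_by i (b j) = b (i + j)"
  by (simp add: b_def conj_by_conj_by)

lemma b_commute: "b i \<otimes> b j = b j \<otimes> b i"
proof -
  have "a \<otimes> b (j - i) = b (j - i) \<otimes> a"
    using conj_commute by (simp add: b_def conj_by_def)
  then have "conj_by i (a \<otimes> b (j - i)) = conj_by i (b (j - i) \<otimes> a)" by simp
  then show ?thesis by (simp add: conj_by_mult conj_by_b flip: b_def)
qed

lemma subgroup_N: "subgroup N G"
  unfolding N_def by (rule generate_is_subgroup) auto

lemma N_carrier: "x \<in> N \<Longrightarrow> x \<in> carrier G"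
  using subgroup.mem_carrier[OF subgroup_N] .

lemma comm_group_N: "comm_group NG"
  unfolding N_def by (rule comm_group_generate) (auto simp: b_commute)

sublocale NG: comm_group NG
  by (rule comm_group_N)

lemma N_commute: "\<lbrakk>x \<in> N; y \<in> N\<rbrakk> \<Longrightarrow> x \<otimes> y = y \<otimes> x"
  using NG.m_comm by simp

lemma b_N [simp]: "b i \<in> N"
  unfolding N_def by (rule generate.incl) simp

lemma a_N [simp]: "a \<in> N"
  using b_N[of 0] by (simp add: b_def)

lemma N_pow: "x \<in> N \<Longrightarrow> x [^] (n::int) \<in> N"
  using subgroup_int_pow_closed[OF subgroup_N] .

lemma N_nat_pow: "x \<in> N \<Longrightarrow> x [^] (n::nat) \<in> N"
  using N_pow[of x "int n"] by (simp add: int_pow_int)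

lemma N_mult: "\<lbrakk>x \<in> N; y \<in> N\<rbrakk> \<Longrightarrow> x \<otimes> y \<in> N"
  using subgroup.m_closed[OF subgroup_N] .

lemma N_inv: "x \<in> N \<Longrightarrow> inv x \<in> N"
  using subgroup.m_inv_closed[OF subgroup_N] .

lemma N_one [simp]: "\<one> \<in> N"
  using subgroup.one_closed[OF subgroup_N] .

lemma conj_by_N: "x \<in> N \<Longrightarrow> conj_by i x \<in> N"
proof -
  assume "x \<in> N"
  interpret c: group_hom G G "conj_by i" by unfold_locales (rule conj_by_hom)
  have "conj_by i ` N = generate G (conj_by i ` range b)"
    unfolding N_def by (rule c.generate_img[symmetric]) auto
  also have "\<dots> \<subseteq> N"
    by (rule generate_subgroup_incl) (auto simp: conj_by_b subgroup_N)
  finally show ?thesis using \<open>x \<in> N\<close> by blast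
qed

lemma conj_by_hom_N: "conj_by i \<in> hom NG NG"
  by (rule homI) (simp_all add: conj_by_N conj_by_mult N_carrier)

lemma pow_hom_N: "(\<lambda>x. x [^] (n::int)) \<in> hom NG NG"
  by (rule homI) (simp_all add: N_pow int_pow_mult_distrib N_commute N_carrier)

text \<open>Outside the support the factors are trivial. This allows functions with different
  supports to be compared over one finite index set.\<close>

lemma \<Phi>_superset:
  assumes "finite S" "{i. f i \<noteq> 0} \<subseteq> S"
  shows "\<Phi> f = finprod NG (\<lambda>i. b i [^] f i) S"
  unfolding \<Phi>_def
  by (rule NG.finprod_mono_neutral_cong_left) (use assms in \<open>auto simp: N_pow\<close>)

lemma \<Phi>_N [simp]: "\<Phi> f \<in> N"
  unfolding \<Phi>_def using NG.finprod_closed[of "\<lambda>i. b i [^] f i"] by (auto simp: N_pow)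

lemma \<Phi>_closed [simp]: "\<Phi> f \<in> carrier G"
  using N_carrier by simp

lemma \<Phi>_0 [simp]: "\<Phi> (\<lambda>_. 0) = \<one>"
  by (simp add: \<Phi>_def)

lemma \<Phi>_add:
  assumes "finite {i. f i \<noteq> 0}" "finite {i. h i \<noteq> 0}"
  shows "\<Phi> (\<lambda>i. f i + h i) = \<Phi> f \<otimes> \<Phi> h"
proof -
  let ?S = "{i. f i \<noteq> 0} \<union> {i. h i \<noteq> 0}"
  have "\<Phi> (\<lambda>i. f i + h i) = finprod NG (\<lambda>i. b i [^] (f i + h i)) ?S"
    by (rule \<Phi>_superset) (use assms in auto)
  also have "\<dots> = finprod NG (\<lambda>i. b i [^] f i \<otimes>\<^bsub>NG\<^esub> b i [^] h i) ?S"
    by (rule NG.finprod_cong) (auto simp: simp_implies_def N_pow N_mult int_pow_mult)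
  also have "\<dots> = finprod NG (\<lambda>i. b i [^] f i) ?S \<otimes>\<^bsub>NG\<^esub> finprod NG (\<lambda>i. b i [^] h i) ?S"
    by (rule NG.finprod_multf) (auto simp: N_pow)
  also have "finprod NG (\<lambda>i. b i [^] f i) ?S = \<Phi> f"
    by (rule \<Phi>_superset[symmetric]) (use assms in auto)
  also have "finprod NG (\<lambda>i. b i [^] h i) ?S = \<Phi> h"
    by (rule \<Phi>_superset[symmetric]) (use assms in auto)
  finally show ?thesis by simp
qed

lemma \<Phi>_cmult:
  assumes "finite {i. f i \<noteq> 0}"
  shows "\<Phi> (\<lambda>i. c * f i) = \<Phi> f [^] (c::int)"
proof -
  have "\<Phi> f [^] c = finprod NG (\<lambda>i. (b i [^] f i) [^] c) {i. f i \<noteq> 0}"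
    unfolding \<Phi>_def
    by (rule hom_finprod[OF comm_group_N comm_group_N pow_hom_N]) (auto simp: N_pow)
  also have "\<dots> = finprod NG (\<lambda>i. b i [^] (c * f i)) {i. f i \<noteq> 0}"
    by (rule NG.finprod_cong) (auto simp: simp_implies_def N_pow int_pow_pow mult.commute)
  also have "\<dots> = \<Phi> (\<lambda>i. c * f i)"
    by (rule \<Phi>_superset[symmetric]) (use assms in auto)
  finally show ?thesis ..
qed

lemma finite_support_shift:
  fixes k :: int
  assumes "finite {i. f i \<noteq> (0::int)}"
  shows "finite {i. f (i + k) \<noteq> (0::int)}"
proof -
  have "{i. f (i + k) \<noteq> 0} = (\<lambda>i. i - k) ` {i. f i \<noteq> 0}"
    by (auto intro!: image_eqI[of _ _ "_ + k"])
  then show ?thesis using assms by simp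
qed

text \<open>Conjugation by \<open>g [^] (- k)\<close> sends \<open>b (i + k)\<close> to
  \<open>b i\<close>, so it only reindexes the product. For an infinite support both sides are
  trivial by the convention for \<open>finprod\<close>.\<close>

lemma \<Phi>_shift:
  "\<Phi> (\<lambda>i. f (i + k)) = conj_by (- k) (\<Phi> f)"
proof -
  have S: "{i. f i \<noteq> 0} = (\<lambda>i. i + k) ` {i. f (i + k) \<noteq> 0}"
    by (auto intro!: image_eqI[of _ _ "_ - k"])
  have "conj_by (- k) (\<Phi> f) = finprod NG (\<lambda>i. conj_by (- k) (b i [^] f i)) {i. f i \<noteq> 0}"
    unfolding \<Phi>_def
    by (rule hom_finprod[OF comm_group_N comm_group_N conj_by_hom_N]) (auto simp: N_pow)
  also have "\<dots> = finprod NG (\<lambda>i. conj_by (- k) (b (i + k) [^] f (i + k))) {i. f (i + k) \<noteq> 0}"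
    unfolding S by (rule NG.finprod_reindex) (auto simp: inj_on_def conj_by_N N_pow)
  also have "\<dots> = \<Phi> (\<lambda>i. f (i + k))"
    unfolding \<Phi>_def by (rule NG.finprod_cong) (auto simp: simp_implies_def N_pow conj_by_int_pow conj_by_b)
  finally show ?thesis ..
qed

lemma \<Phi>_single: "\<Phi> (\<lambda>i. if i = k then c else 0) = b k [^] c"
  by (subst \<Phi>_superset[of "{k}"]) (auto simp: N_pow NG.finprod_insert N_carrier)

text \<open>All conjugates of \<open>a\<close> have trivial \<open>n\<close>-th power. The case
  \<open>n = 0\<close> is included, because reduction modulo zero is the identity.\<close>

lemma \<Phi>_mod:
  assumes "finite {i. f i \<noteq> 0}" "a [^] n = \<one>"
  shows "\<Phi> (\<lambda>i. f i mod int n) = \<Phi> f"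
proof -
  have "b i [^] n = \<one>" for i using assms(2) by (simp add: b_def flip: conj_by_pow)
  then have *: "b i [^] (int n * k) = \<one>" for i k
    by (simp add: int_pow_int flip: int_pow_pow)
  have "b i [^] (f i mod int n) = b i [^] f i" for i
  proof -
    have "b i [^] (f i mod int n) = b i [^] (int n * (f i div int n)) \<otimes> b i [^] (f i mod int n)"
      by (simp add: *)
    also have "\<dots> = b i [^] f i" by (simp flip: int_pow_mult)
    finally show ?thesis .
  qed
  then have "\<Phi> f = finprod NG (\<lambda>i. b i [^] (f i mod int n)) {i. f i \<noteq> 0}"
    by (simp add: \<Phi>_def)
  also have "\<dots> = \<Phi> (\<lambda>i. f i mod int n)"
    by (rule \<Phi>_superset[symmetric]) (use assms in auto)
  finally show ?thesis ..
qed

text \<open>This is the multiplication rule of a semidirect product: moving \<open>g [^] k\<close>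
  to the right past \<open>\<Phi> f'\<close> conjugates it by \<open>g [^] (- k)\<close>, which
  translates \<open>f'\<close>.\<close>

lemma normal_form_mult:
  fixes k k' :: int
  assumes "finite {i. f i \<noteq> 0}" "finite {i. f' i \<noteq> 0}"
  shows "\<Phi> f \<otimes> g [^] k \<otimes> (\<Phi> f' \<otimes> g [^] k') = \<Phi> (\<lambda>i. f i + f' (i + k)) \<otimes> g [^] (k + k')"
proof -
  have "g [^] k \<otimes> \<Phi> f' = conj_by (- k) (\<Phi> f') \<otimes> g [^] k"
    by (simp add: conj_by_eq m_assoc int_pow_neg)
  moreover have "\<Phi> f \<otimes> g [^] k \<otimes> (\<Phi> f' \<otimes> g [^] k') = \<Phi> f \<otimes> (g [^] k \<otimes> \<Phi> f') \<otimes> g [^] k'"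
    by (simp add: m_assoc)
  ultimately have "\<Phi> f \<otimes> g [^] k \<otimes> (\<Phi> f' \<otimes> g [^] k') = \<Phi> f \<otimes> (conj_by (- k) (\<Phi> f') \<otimes> g [^] k) \<otimes> g [^] k'"
    by simp
  also have "\<dots> = \<Phi> f \<otimes> conj_by (- k) (\<Phi> f') \<otimes> g [^] (k + k')"
    by (simp add: m_assoc int_pow_mult)
  also have "\<Phi> f \<otimes> conj_by (- k) (\<Phi> f') = \<Phi> (\<lambda>i. f i + f' (i + k))"
    using \<Phi>_add[OF assms(1) finite_support_shift[OF assms(2)]] by (simp add: \<Phi>_shift)
  finally show ?thesis .
qed

lemma generate_normal_form:
  "generate G {a, g} = {\<Phi> f \<otimes> g [^] k | f (k::int). finite {i. f i \<noteq> 0}}" (is "_ = ?E")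
proof
  have E: "\<Phi> f \<otimes> g [^] k \<in> ?E" if "finite {i. f i \<noteq> 0}" for f and k :: int
    using that by blast
  have "x \<in> ?E" if "x \<in> generate G {a, g}" for x
    using that
  proof (induction rule: generate.induct)
    case one
    show ?case using E[of "\<lambda>_. 0" 0] by simp
  next
    case (incl h)
    have "a \<in> ?E" using E[of "\<lambda>i. if i = 0 then 1 else 0" 0] by (simp add: \<Phi>_single b_def)
    moreover have "g \<in> ?E" using E[of "\<lambda>_. 0" 1] by simp
    ultimately show ?case using incl by blast
  next
    case (inv h)
    have "inv a \<in> ?E"
      using E[of "\<lambda>i. if i = 0 then - 1 else 0" 0] by (simp add: \<Phi>_single b_def int_pow_neg)
    moreover have "inv g \<in> ?E" using E[of "\<lambda>_. 0" "- 1"] by (simp add: int_pow_neg)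
    ultimately show ?case using inv by blast
  next
    case (eng x y)
    then obtain f k f' k' where "x = \<Phi> f \<otimes> g [^] (k::int)" "y = \<Phi> f' \<otimes> g [^] (k'::int)"
      and fin: "finite {i. f i \<noteq> 0}" "finite {i. f' i \<noteq> 0}" by blast
    then have "x \<otimes> y = \<Phi> (\<lambda>i. f i + f' (i + k)) \<otimes> g [^] (k + k')"
      by (simp only: normal_form_mult)
    moreover have "finite {i. f i + f' (i + k) \<noteq> 0}"
      by (rule finite_subset[OF _ finite_UnI[OF fin(1) finite_support_shift[OF fin(2), of k]]]) auto
    ultimately show ?case using E by simp
  qed
  then show "generate G {a, g} \<subseteq> ?E" by blast
  have sub: "subgroup (generate G {a, g}) G" by (rule generate_is_subgroup) simp
  have ag: "a \<in> generate G {a, g}" "g \<in> generate G {a, g}" by (auto intro: generate.incl)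
  have gk: "g [^] k \<in> generate G {a, g}" for k :: int
    using subgroup_int_pow_closed[OF sub ag(2)] .
  have "range b \<subseteq> generate G {a, g}"
    using ag(1) gk subgroup.m_closed[OF sub] subgroup.m_inv_closed[OF sub] by (auto simp: b_def conj_by_eq)
  then have "N \<subseteq> generate G {a, g}"
    unfolding N_def by (rule generate_subgroup_incl[OF _ sub])
  then show "?E \<subseteq> generate G {a, g}" using \<Phi>_N gk subgroup.m_closed[OF sub] by blast
qed

text \<open>The conjugates of \<open>a\<close> are torsion and commute, so
  \<open>finite_generate_torsion\<close> applies inside \<open>NG\<close>.\<close>

lemma finite_generate_powers:
  assumes "n > 0" "a [^] (n::nat) = \<one>" "finite I"
  shows "finite (generate G (b ` I))"
proof -
  have "finite (generate NG (b ` I))"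
  proof (rule NG.finite_generate_torsion)
    show "finite (b ` I)" "b ` I \<subseteq> carrier NG" using assms(3) by auto
    fix s assume "s \<in> b ` I"
    then obtain i where "s = b i" by blast
    then have "s [^] n = \<one>" using assms(2) by (simp add: b_def flip: conj_by_pow)
    then show "\<exists>n>0. s [^]\<^bsub>NG\<^esub> (n::nat) = \<one>\<^bsub>NG\<^esub>"
      using assms(1) by (auto simp flip: nat_pow_consistent)
  qed
  then show ?thesis using generate_consistent[OF _ subgroup_N, of "b ` I"] by (simp add: image_subset_iff)
qed

end

section \<open>Free pairs and a criterion for wreath products\<close>

locale free_conjugates = commuting_conjugates +
  assumes not_commute: "\<And>m::nat. m > 0 \<Longrightarrow> g [^] m \<otimes> a \<noteq> a \<otimes> g [^] m"
begin

lemma b_neq_a: "i \<noteq> 0 \<Longrightarrow> b i \<noteq> a"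
proof
  assume i: "i \<noteq> 0" and "b i = a"
  then have "conj_by i a = a" by (simp add: b_def)
  \<comment> \<open>A negative exponent is inverted, since \<open>not_commute\<close> speaks of
    positive powers.\<close>
  moreover from this have "conj_by (- i) a = a" using conj_by_conj_by[of a "- i" i] by simp
  ultimately have "conj_by (int (nat \<bar>i\<bar>)) a = a" by (cases "i \<ge> 0") auto
  then have "g [^] (nat \<bar>i\<bar>) \<otimes> a = a \<otimes> g [^] (nat \<bar>i\<bar>)"
    by (subst (asm) conj_by_eq_iff) (simp_all add: int_pow_int del: int_nat_eq)
  then show False using not_commute[of "nat \<bar>i\<bar>"] i by simp
qed

lemma inj_b: "inj b"
proof (rule injI)
  fix i j assume "b i = b j"
  then have "conj_by (- j) (b i) = conj_by (- j) (b j)" by simp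
  then have "b (i - j) = a" by (simp add: conj_by_b) (simp add: b_def)
  then show "i = j" using b_neq_a[of "i - j"] by auto
qed

text \<open>\<open>N\<close> is abelian and contains \<open>a\<close>, so a power of
  \<open>g\<close> inside \<open>N\<close> commutes with \<open>a\<close>.\<close>

lemma pow_in_N: "g [^] (k::int) \<in> N \<Longrightarrow> k = 0"
  using b_neq_a[of k] conj_by_eq_iff[of a k] N_commute[of "g [^] k" a] by (auto simp: b_def)

lemma normal_form_eq_one:
  assumes "\<Phi> f \<otimes> g [^] (k::int) = \<one>"
  shows "k = 0" "\<Phi> f = \<one>"
proof -
  have "g [^] k = inv (\<Phi> f)" using assms by (metis \<Phi>_closed g_closed int_pow_closed inv_equality inv_inv inv_closed inv_comm)
  then show "k = 0" using pow_in_N N_inv by simp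
  then show "\<Phi> f = \<one>" using assms by simp
qed

text \<open>For \<open>n = 0\<close> the group \<open>integer_mod_group n\<close> is the group of integers, so both kinds
  of wreath products are covered.\<close>

lemma wreath_iso:
  assumes n: "a [^] (n::nat) = \<one>"
    and free: "\<And>f. \<lbrakk>finite {i. f i \<noteq> 0}; \<And>i. f i \<in> carrier (integer_mod_group n); \<Phi> f = \<one>\<rbrakk>
      \<Longrightarrow> f = (\<lambda>_. 0)"
  shows "G\<lparr>carrier := generate G {a, g}\<rparr> \<cong> wreath_product (integer_mod_group n) integer_group"
proof -
  let ?W = "wreath_product (integer_mod_group n) integer_group"
  let ?H = "G\<lparr>carrier := generate G {a, g}\<rparr>"
  \<comment> \<open>The sign matters: \<open>wreath_shift\<close> translates by \<open>- k\<close>,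
    whereas \<open>g [^] k\<close> in \<open>normal_form_mult\<close> translates by
    \<open>k\<close>.\<close>
  let ?h = "\<lambda>(f, k). \<Phi> f \<otimes> g [^] (- k)"
  have W: "group ?W" by (rule group_wreath_product) simp_all
  have H: "group ?H" by (rule subgroup_imp_group, rule generate_is_subgroup) simp
  have carr: "carrier ?W = {f. (\<forall>i. f i \<in> carrier (integer_mod_group n)) \<and> finite {i. f i \<noteq> 0}} \<times> UNIV"
    by (auto simp: wreath_product_def semidirect_product_def carrier_sum_group)
  have mult: "(f, k) \<otimes>\<^bsub>?W\<^esub> (f', k') = (\<lambda>i. (f i + f' (i - k)) mod int n, k + k')" for f k f' k'
    by (simp add: wreath_product_def semidirect_product_def wreath_shift_def restrict_UNIV)
  have hom: "?h \<in> hom ?W ?H"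
  proof (rule homI)
    fix x assume "x \<in> carrier ?W"
    then show "?h x \<in> carrier ?H" by (auto simp: carr generate_normal_form)
  next
    fix x y assume "x \<in> carrier ?W" "y \<in> carrier ?W"
    then obtain f k f' k' where xy: "x = (f, k)" "y = (f', k')"
      and fin: "finite {i. f i \<noteq> 0}" "finite {i. f' i \<noteq> 0}" by (auto simp: carr)
    have "finite {i. f i + f' (i + - k) \<noteq> 0}"
      by (rule finite_subset[OF _ finite_UnI[OF fin(1) finite_support_shift[OF fin(2), of "- k"]]]) auto
    then have "\<Phi> (\<lambda>i. (f i + f' (i + - k)) mod int n) = \<Phi> (\<lambda>i. f i + f' (i + - k))"
      by (rule \<Phi>_mod[OF _ n])
    then show "?h (x \<otimes>\<^bsub>?W\<^esub> y) = ?h x \<otimes>\<^bsub>?H\<^esub> ?h y"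
      using normal_form_mult[OF fin, of "- k" "- k'"] by (simp add: xy mult add.commute)
  qed
  interpret h: group_hom ?W ?H ?h
    by (intro group_hom.intro W H group_hom_axioms.intro hom)
  have "?h \<in> iso ?W ?H"
    unfolding h.iso_iff
  proof (intro conjI ballI impI subsetI)
    fix x assume x: "x \<in> carrier ?W" "?h x = \<one>\<^bsub>?H\<^esub>"
    then obtain f k where fk: "x = (f, k)" "\<forall>i. f i \<in> carrier (integer_mod_group n)" "finite {i. f i \<noteq> 0}"
      by (auto simp: carr)
    then have "\<Phi> f \<otimes> g [^] (- k) = \<one>" using x(2) by simp
    then have "k = 0" "\<Phi> f = \<one>" using normal_form_eq_one by fastforce+
    then show "x = \<one>\<^bsub>?W\<^esub>"
      using free[of f] fk by (simp add: wreath_product_def semidirect_product_def restrict_UNIV)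
  next
    fix x assume "x \<in> carrier ?H"
    then obtain f k where x: "x = \<Phi> f \<otimes> g [^] (k::int)" and fin: "finite {i. f i \<noteq> 0}"
      by (auto simp: generate_normal_form)
    \<comment> \<open>Reduction modulo \<open>n\<close> puts the coefficients into
      \<open>integer_mod_group n\<close> without changing the value of
      \<open>\<Phi>\<close>.\<close>
    let ?f = "\<lambda>i. f i mod int n"
    have "finite {i. ?f i \<noteq> 0}" by (rule finite_subset[OF _ fin]) auto
    then have "(?f, - k) \<in> carrier ?W" by (auto simp: carr carrier_integer_mod_group)
    moreover have "x = ?h (?f, - k)" using x \<Phi>_mod[OF fin n] by simp
    ultimately show "x \<in> ?h ` carrier ?W" by blast
  qed
  then show ?thesis using group.iso_sym[OF W] is_isoI by blast
qed

end

section \<open>Integral polynomials in conjugation by \<open>g\<close>\<close>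

context commuting_conjugates
begin

lemma commuting_conjugates_N:
  assumes u: "u \<in> N"
  shows "commuting_conjugates G u g"
proof
  fix i :: int
  have "u \<otimes> conj_by i u = conj_by i u \<otimes> u" using u by (intro N_commute conj_by_N)
  then show "u \<otimes> grp_conjugate G u (g [^] i) = grp_conjugate G u (g [^] i) \<otimes> u"
    by (simp add: conj_by_def)
qed (use u in \<open>simp_all add: N_carrier\<close>)

text \<open>The conjugates of \<open>a [^] d\<close> are the \<open>d\<close>-th powers of those of
  \<open>a\<close>. The products agree factor by factor, although the left one is formed in a
  possibly smaller abelian group.\<close>

lemma \<Phi>_pow:
  assumes "finite {i. f i \<noteq> 0}"
  shows "commuting_conjugates.\<Phi> G (a [^] (d::nat)) g f = \<Phi> (\<lambda>i. int d * f i)"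
proof -
  interpret d: commuting_conjugates G "a [^] d" g
    by (rule commuting_conjugates_N[OF N_nat_pow[OF a_N]])
  have db: "d.b i = b i [^] d" for i
    unfolding d.b_def b_def by (rule conj_by_pow) simp
  have NN: "d.N \<subseteq> N"
    unfolding d.N_def by (rule generate_subgroup_incl[OF _ subgroup_N]) (auto simp: db N_nat_pow)
  then have hom: "(\<lambda>x. x) \<in> hom d.NG NG" by (intro homI) auto
  have "d.\<Phi> f = finprod NG (\<lambda>i. d.b i [^] f i) {i. f i \<noteq> 0}"
    unfolding d.\<Phi>_def
    by (rule hom_finprod[OF d.comm_group_N comm_group_N hom]) (auto simp: d.N_pow)
  also have "\<dots> = finprod NG (\<lambda>i. b i [^] (int d * f i)) {i. f i \<noteq> 0}"
    by (rule NG.finprod_cong) (auto simp: simp_implies_def N_pow N_nat_pow db int_pow_int simp flip: int_pow_pow)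
  also have "\<dots> = \<Phi> (\<lambda>i. int d * f i)"
    by (rule \<Phi>_superset[symmetric]) (use assms in auto)
  finally show ?thesis .
qed

text \<open>Needed to carry normal forms from a presented group over to \<open>G\<close>: a
  homomorphism maps the conjugates of \<open>a\<close> to those of \<open>h a\<close>.\<close>

lemma \<Phi>_hom:
  assumes "group_hom G H h" "commuting_conjugates H (h a) (h g)"
  shows "commuting_conjugates.\<Phi> H (h a) (h g) f = h (\<Phi> f)"
proof -
  interpret h: group_hom G H h by fact
  interpret H: commuting_conjugates H "h a" "h g" by fact
  have hb: "h (b i) = H.b i" for i
    by (simp add: b_def H.b_def conj_by_eq H.conj_by_eq h.hom_int_pow)
  have "h ` N = generate H (h ` range b)"
    unfolding N_def by (rule h.generate_img[symmetric]) auto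
  also have "h ` range b = range H.b" by (simp add: image_image hb)
  finally have hN: "h ` N = H.N" by (simp add: H.N_def)
  then have hom: "h \<in> hom NG H.NG" by (intro homI) (auto simp: N_carrier)
  have "h (\<Phi> f) = finprod H.NG (\<lambda>i. h (b i [^] f i)) {i. f i \<noteq> 0}"
    unfolding \<Phi>_def
    by (rule hom_finprod[OF comm_group_N H.comm_group_N hom]) (auto simp: N_pow)
  also have "\<dots> = H.\<Phi> f"
    unfolding H.\<Phi>_def
    by (rule H.NG.finprod_cong) (auto simp: simp_implies_def hb h.hom_int_pow H.N_pow)
  finally show ?thesis ..
qed

lemma \<Phi>_generate:
  assumes "{i. f i \<noteq> 0} \<subseteq> I"
  shows "\<Phi> f \<in> generate G (b ` I)"
proof -
  have sub: "subgroup (generate G (b ` I)) G" by (rule generate_is_subgroup) auto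
  have "finprod NG (\<lambda>i. b i [^] f i) F \<in> generate G (b ` I)" if "F \<subseteq> I" for F
    using that
  proof (induction F rule: infinite_finite_induct)
    case (insert i F)
    have "finprod NG (\<lambda>i. b i [^] f i) (insert i F) = b i [^] f i \<otimes> finprod NG (\<lambda>i. b i [^] f i) F"
      using insert.hyps by (subst NG.finprod_insert) (auto simp: N_pow)
    moreover have "b i [^] f i \<in> generate G (b ` I)"
      using insert.prems by (intro subgroup_int_pow_closed[OF sub] generate.incl) auto
    ultimately show ?case using insert by (simp add: generate.eng)
  qed (simp_all add: generate.one)
  then show ?thesis using assms by (simp add: \<Phi>_def)
qed

text \<open>The case distinction is essential: \<open>nat\<close> sends negative integers to zero,
  which would repeat the constant coefficient at every negative index.\<close>

abbreviation poly_fun :: "int poly \<Rightarrow> int \<Rightarrow> int" where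
  "poly_fun p i \<equiv> if i < 0 then 0 else poly.coeff p (nat i)"

definition \<Psi> :: "int poly \<Rightarrow> 'a" where
  "\<Psi> p = \<Phi> (poly_fun p)"

lemma support_poly: "{i. poly_fun p i \<noteq> 0} \<subseteq> {0..<int (Suc (degree p))}"
  using le_degree[of p] by (force split: if_splits simp: nat_le_iff)

lemma finite_support_poly: "finite {i. poly_fun p i \<noteq> 0}"
  by (rule finite_subset[OF support_poly]) simp

lemma \<Psi>_closed [simp]: "\<Psi> p \<in> carrier G"
  by (simp add: \<Psi>_def)

lemma \<Psi>_0 [simp]: "\<Psi> 0 = \<one>"
proof -
  have "poly_fun 0 = (\<lambda>_. 0)" by auto
  then show ?thesis by (simp only: \<Psi>_def \<Phi>_0)
qed

lemma \<Psi>_1: "\<Psi> 1 = a"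
proof -
  have "poly_fun 1 = (\<lambda>i. if i = 0 then 1 else 0)" by auto
  then show ?thesis by (simp only: \<Psi>_def \<Phi>_single) (simp add: b_def)
qed

lemma \<Psi>_add: "\<Psi> (p + q) = \<Psi> p \<otimes> \<Psi> q"
proof -
  have "poly_fun (p + q) = (\<lambda>i. poly_fun p i + poly_fun q i)" by auto
  then show ?thesis unfolding \<Psi>_def by (simp only: \<Phi>_add[OF finite_support_poly finite_support_poly])
qed

lemma \<Psi>_smult: "\<Psi> (smult c p) = \<Psi> p [^] c"
proof -
  have "poly_fun (smult c p) = (\<lambda>i. c * poly_fun p i)" by auto
  then show ?thesis unfolding \<Psi>_def by (simp only: \<Phi>_cmult[OF finite_support_poly])
qed

lemma \<Psi>_pCons_0: "\<Psi> (pCons 0 p) = conj_by 1 (\<Psi> p)"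
proof -
  have "poly_fun (pCons 0 p) i = poly_fun p (i + - 1)" for i
    by (cases "i > 0") (auto simp: coeff_pCons nat_diff_distrib split: nat.splits)
  then have "poly_fun (pCons 0 p) = (\<lambda>i. poly_fun p (i + - 1))" by blast
  then show ?thesis using \<Phi>_shift[of "poly_fun p" "- 1"] unfolding \<Psi>_def by (simp only: minus_minus)
qed

text \<open>The annihilator of \<open>a\<close> is an ideal: it is closed under sums, scalars and
  multiplication by the indeterminate, and these build up every multiple of
  \<open>p\<close>.\<close>

lemma \<Psi>_mult: "\<Psi> p = \<one> \<Longrightarrow> \<Psi> (q * p) = \<one>"
  by (induction q rule: pCons_induct) (simp_all add: \<Psi>_add \<Psi>_smult \<Psi>_pCons_0)

lemma \<Psi>_pow: "commuting_conjugates.\<Psi> G (a [^] (d::nat)) g p = \<Psi> (smult (int d) p)"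
proof -
  interpret d: commuting_conjugates G "a [^] d" g
    by (rule commuting_conjugates_N[OF N_nat_pow[OF a_N]])
  show ?thesis
    by (simp only: d.\<Psi>_def \<Phi>_pow[OF finite_support_poly] \<Phi>_cmult[OF finite_support_poly] \<Psi>_smult)
      (simp only: \<Psi>_def)
qed

text \<open>Multiplying by a power of the indeterminate turns a Laurent polynomial into an ordinary
  one. On the group side this is an invertible conjugation, so no relations are lost.\<close>

lemma \<Phi>_poly:
  assumes fin: "finite {i. f i \<noteq> 0}"
  obtains k p where "f = (\<lambda>i. poly_fun p (i + k))" "\<Phi> f = conj_by (- k) (\<Psi> p)"
proof -
  \<comment> \<open>\<open>m\<close> bounds the support in absolute value. For \<open>f = 0\<close>
    the maximum is unspecified, but any shift works then.\<close>
  define m where "m = Max (abs ` {i. f i \<noteq> 0})"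
  have m: "\<bar>i\<bar> \<le> m" if "f i \<noteq> 0" for i
    unfolding m_def using fin that by (intro Max_ge) auto
  define p where "p = Abs_poly (\<lambda>n. f (int n - m))"
  have "f (int n - m) = 0" if "n > nat (2 * m)" for n
    using m[of "int n - m"] that by (cases "f (int n - m) = 0") auto
  then have p: "poly.coeff p n = f (int n - m)" for n
    unfolding p_def by (subst coeff_Abs_poly[of "nat (2 * m)"]) auto
  have "f i = poly_fun p (i + m)" for i
    using m[of i] by (cases "f i = 0") (auto simp: p)
  then have f: "f = (\<lambda>i. poly_fun p (i + m))" by (rule ext)
  show thesis
  proof (rule that[OF f])
    show "\<Phi> f = conj_by (- m) (\<Psi> p)" unfolding f \<Psi>_def by (rule \<Phi>_shift)
  qed
qed

text \<open>The left side has exactly the shape of the last relator of a Gc-group, so the relator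
  holds if and only if the polynomial annihilates \<open>a\<close>.\<close>

lemma foldr_conjugates:
  "foldr (\<otimes>) (map (\<lambda>i. grp_conjugate G a (g [^] i) [^] poly.coeff p i) [0..<Suc (degree p)]) \<one> = \<Psi> p"
proof -
  have foldr_snoc: "foldr (\<otimes>) (xs @ [x]) \<one> = foldr (\<otimes>) xs \<one> \<otimes> x"
    if "set xs \<subseteq> carrier G" "x \<in> carrier G" for xs x
  proof -
    have "foldr (\<otimes>) xs \<one> \<in> carrier G" if "set xs \<subseteq> carrier G" for xs
      using that by (induction xs) auto
    then show ?thesis using that by (induction xs) (auto simp: m_assoc)
  qed
  have "foldr (\<otimes>) (map (\<lambda>i. b (int i) [^] poly.coeff p i) [0..<n]) \<one>
      = finprod NG (\<lambda>i. b i [^] poly_fun p i) {0..<int n}" for n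
  proof (induction n)
    case (Suc n)
    have "{0..<int (Suc n)} = insert (int n) {0..<int n}" by auto
    then have "finprod NG (\<lambda>i. b i [^] poly_fun p i) {0..<int (Suc n)}
        = b (int n) [^] poly.coeff p n \<otimes> finprod NG (\<lambda>i. b i [^] poly_fun p i) {0..<int n}"
      by (simp only:) (subst NG.finprod_insert, auto simp: N_pow)
    \<comment> \<open>\<open>finprod_insert\<close> puts the new factor on the left, the list has it
      on the right; \<open>N\<close> is abelian.\<close>
    also have "\<dots> = finprod NG (\<lambda>i. b i [^] poly_fun p i) {0..<int n} \<otimes> b (int n) [^] poly.coeff p n"
      using NG.finprod_closed[of "\<lambda>i. b i [^] poly_fun p i" "{0..<int n}"]
      by (intro N_commute) (auto simp: N_pow)
    also have "\<dots> = foldr (\<otimes>) (map (\<lambda>i. b (int i) [^] poly.coeff p i) [0..<Suc n]) \<one>"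
      by (simp add: foldr_snoc image_subset_iff Suc del: foldr_append)
    finally show ?case ..
  qed simp
  then have "foldr (\<otimes>) (map (\<lambda>i. b (int i) [^] poly.coeff p i) [0..<Suc (degree p)]) \<one> = \<Psi> p"
    unfolding \<Psi>_def by (simp only: \<Phi>_superset[OF _ support_poly] finite_atLeastLessThan_int)
  moreover have "b (int i) = grp_conjugate G a (g [^] i)" for i
    by (simp add: b_def conj_by_def int_pow_int)
  ultimately show ?thesis by (simp only:)
qed

end

section \<open>Homomorphisms from free groups\<close>

text \<open>Words are evaluated letter by letter. A single cancellation leaves the value unchanged,
  so evaluation is constant on the classes of \<open>free_rel\<close>.\<close>

lemma (in group) free_group_universal:
  assumes \<phi>: "\<And>x. \<phi> x \<in> carrier G"
  obtains h where "h \<in> hom free_group G" "\<And>x. h (free_gen x) = \<phi> x"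
proof -
  define ev where "ev w = foldr (\<otimes>) (map (\<lambda>(x, c). if c then \<phi> x else inv (\<phi> x)) w) \<one>" for w
  have ev_closed [simp]: "ev w \<in> carrier G" for w
    unfolding ev_def by (induction w) (auto simp: \<phi>)
  have ev_Cons: "ev ((x, c) # w) = (if c then \<phi> x else inv (\<phi> x)) \<otimes> ev w" for x c w
    by (simp add: ev_def)
  have ev_append: "ev (u @ v) = ev u \<otimes> ev v" for u v
  proof (induction u)
    case Nil
    have "ev [] = \<one>" by (simp add: ev_def)
    then show ?case by simp
  next
    case (Cons y u)
    then show ?case by (cases y) (simp add: ev_Cons m_assoc \<phi>)
  qed
  have step: "ev u = ev v" if "free_cancel u v" for u v
    using that by cases (simp add: ev_append ev_Cons \<phi>)
  have ev_rel: "ev u = ev v" if "(u, v) \<in> free_rel" for u v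
  proof -
    have "equivclp free_cancel u v" using that by (simp add: free_rel_def)
    then show ?thesis by (induction rule: equivclp_induct) (auto dest: step)
  qed
  \<comment> \<open>The choice of representative is harmless by \<open>ev_rel\<close>.\<close>
  define h where "h U = ev (SOME u. u \<in> U)" for U
  have h: "h (free_rel `` {u}) = ev u" for u
  proof -
    have "u \<in> free_rel `` {u}" using equiv_class_self[OF equiv_free_rel] by auto
    then have "(SOME v. v \<in> free_rel `` {u}) \<in> free_rel `` {u}" by (rule someI)
    then show ?thesis unfolding h_def by (metis ev_rel ImageE singletonD)
  qed
  show thesis
  proof
    show "h \<in> hom free_group G"
      by (rule homI) (auto simp: carrier_free_group h mult_free_group ev_append)
    show "h (free_gen x) = \<phi> x" for x
      by (simp add: free_gen_def h ev_def \<phi>)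
  qed
qed

lemma free_gen_carrier [simp]: "free_gen x \<in> carrier free_group"
  by (simp add: free_gen_def carrier_free_group)

lemma carrier_free_group_generate: "carrier free_group = generate free_group (range free_gen)"
proof
  interpret F: group free_group by (rule group_free_group)
  have inv: "inv\<^bsub>free_group\<^esub> free_gen x = free_rel `` {[(x, False)]}" for x :: 'a
  proof (rule F.inv_equality)
    show "free_rel `` {[(x, False)]} \<otimes>\<^bsub>free_group\<^esub> free_gen x = \<one>\<^bsub>free_group\<^esub>"
      unfolding free_gen_def mult_free_group one_free_group
      using free_rel_inverse[of "[(x, True)]"] by (intro equiv_class_eq[OF equiv_free_rel]) simp
  qed (simp_all add: carrier_free_group free_gen_def)
  have "free_rel `` {w} \<in> generate free_group (range free_gen)" for w :: "('a \<times> bool) list"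
  proof (induction w)
    case Nil
    show ?case using generate.one[of free_group] by (simp add: one_free_group)
  next
    case (Cons l w)
    obtain x c where l: "l = (x, c)" by (cases l)
    have "free_rel `` {[l]} \<in> generate free_group (range free_gen)"
    proof (cases c)
      case True
      then show ?thesis
        using generate.incl[OF rangeI[of free_gen x], of free_group] by (simp add: l free_gen_def)
    next
      case False
      then show ?thesis using generate.inv[of "free_gen x" "range free_gen" free_group] by (simp add: l inv)
    qed
    then have "free_rel `` {[l]} \<otimes>\<^bsub>free_group\<^esub> free_rel `` {w} \<in> generate free_group (range free_gen)"
      using Cons by (rule generate.eng)
    then show ?case by (simp add: mult_free_group)
  qed
  then show "carrier free_group \<subseteq> generate free_group (range free_gen :: ('a \<times> bool) list set set)"
    by (auto simp: carrier_free_group)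
  show "generate free_group (range free_gen) \<subseteq> carrier (free_group :: ('a \<times> bool) list set monoid)"
    by (rule F.generate_incl) auto
qed

lemma (in group_hom) hom_grp_conjugate:
  "\<lbrakk>x \<in> carrier G; y \<in> carrier G\<rbrakk> \<Longrightarrow> h (grp_conjugate G x y) = grp_conjugate H (h x) (h y)"
  by (simp add: grp_conjugate_def)

lemma (in group_hom) hom_grp_commutator:
  "\<lbrakk>x \<in> carrier G; y \<in> carrier G\<rbrakk> \<Longrightarrow> h (grp_commutator G x y) = grp_commutator H (h x) (h y)"
  by (simp add: grp_commutator_def)

lemma (in group) grp_conjugate_closed [simp]:
  "\<lbrakk>x \<in> carrier G; y \<in> carrier G\<rbrakk> \<Longrightarrow> grp_conjugate G x y \<in> carrier G"
  by (simp add: grp_conjugate_def)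

lemma (in group) grp_commutator_eq_one:
  assumes "x \<in> carrier G" "y \<in> carrier G"
  shows "grp_commutator G x y = \<one> \<longleftrightarrow> x \<otimes> y = y \<otimes> x"
proof -
  have "grp_commutator G x y = inv (y \<otimes> x) \<otimes> (x \<otimes> y)"
    using assms by (simp add: grp_commutator_def inv_mult_group m_assoc)
  moreover have "x \<otimes> y = y \<otimes> x" if "inv (y \<otimes> x) \<otimes> (x \<otimes> y) = \<one>"
    using inv_cancel(2)[of "y \<otimes> x" "x \<otimes> y"] that assms by simp
  ultimately show ?thesis using assms by auto
qed

lemma (in group_hom) hom_foldr:
  "set xs \<subseteq> carrier G \<Longrightarrow> h (foldr (\<otimes>) xs \<one>) = foldr (\<otimes>\<^bsub>H\<^esub>) (map h xs) \<one>\<^bsub>H\<^esub>"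
proof (induction xs)
  case (Cons x xs)
  have "foldr (\<otimes>) ys \<one> \<in> carrier G" if "set ys \<subseteq> carrier G" for ys
    using that by (induction ys) auto
  then show ?case using Cons by simp
qed simp

text \<open>Used in both directions: the quotient map kills the relators, so the presented group has
  commuting conjugates; conversely the relations in \<open>G\<close> give a map out of the presented
  group.\<close>

lemma Gc_relators_trivial_iff:
  fixes h :: "(Gc_gen \<times> bool) list set \<Rightarrow> 'h" and H :: "('h, 'm) monoid_scheme" (structure)
  assumes "group_hom free_group H h"
  defines "x \<equiv> h (free_gen Beta)" and "y \<equiv> h (free_gen Alpha)"
  shows "(\<forall>r\<in>Gc_relators s c. h r = \<one>) \<longleftrightarrow>
    (\<forall>i::int. x \<otimes> grp_conjugate H x (y [^] i) = grp_conjugate H x (y [^] i) \<otimes> x) \<and>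
    foldr (\<otimes>) (map (\<lambda>i. grp_conjugate H x (y [^] i) [^] c i) [0..<Suc s]) \<one> = \<one>"
proof -
  interpret h: group_hom free_group H h by fact
  let ?F = "free_group :: (Gc_gen \<times> bool) list set monoid"
  let ?a = "free_gen Alpha" and ?b = "free_gen Beta"
  have xy: "x \<in> carrier H" "y \<in> carrier H" by (simp_all add: x_def y_def)
  have "h (grp_commutator ?F ?b (grp_conjugate ?F ?b (?a [^]\<^bsub>?F\<^esub> i))) = \<one> \<longleftrightarrow>
      x \<otimes> grp_conjugate H x (y [^] i) = grp_conjugate H x (y [^] i) \<otimes> x" for i :: int
    using xy by (simp add: h.hom_grp_commutator h.hom_grp_conjugate h.hom_int_pow
        h.H.grp_commutator_eq_one flip: x_def y_def)
  moreover have "h (foldr (\<otimes>\<^bsub>?F\<^esub>) (map (\<lambda>i. grp_conjugate ?F ?b (?a [^]\<^bsub>?F\<^esub> i) [^]\<^bsub>?F\<^esub> c i) [0..<Suc s]) \<one>\<^bsub>?F\<^esub>)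
    = foldr (\<otimes>) (map (\<lambda>i. grp_conjugate H x (y [^] i) [^] c i) [0..<Suc s]) \<one>"
    by (subst h.hom_foldr)
      (auto simp: h.hom_grp_conjugate h.hom_int_pow h.hom_nat_pow o_def x_def y_def simp del: upt_Suc foldr_map)
  moreover have "(\<forall>r\<in>Gc_relators s c. h r = \<one>) \<longleftrightarrow>
    (\<forall>i::int. h (grp_commutator ?F ?b (grp_conjugate ?F ?b (?a [^]\<^bsub>?F\<^esub> i))) = \<one>) \<and>
    h (foldr (\<otimes>\<^bsub>?F\<^esub>) (map (\<lambda>i. grp_conjugate ?F ?b (?a [^]\<^bsub>?F\<^esub> i) [^]\<^bsub>?F\<^esub> c i) [0..<Suc s]) \<one>\<^bsub>?F\<^esub>) = \<one>"
    unfolding Gc_relators_def ball_Un ball_simps by blast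
  ultimately show ?thesis by (simp only:)
qed

lemma (in group_hom) normal_closure_subset_kernel:
  assumes "R \<subseteq> carrier G" "\<And>r. r \<in> R \<Longrightarrow> h r = \<one>\<^bsub>H\<^esub>"
  shows "normal_closure G R \<subseteq> kernel G H h"
  unfolding normal_closure_def using normal_kernel assms by (auto simp: kernel_def)

section \<open>The three types of subgroups\<close>

context free_conjugates
begin

text \<open>The presented group also has commuting conjugates, hence the same normal forms as the
  subgroup generated by \<open>a\<close> and \<open>g\<close>. A normal form that becomes trivial in
  \<open>G\<close> comes from a multiple of \<open>p\<close>, and such multiples are already trivial
  in the presented group.\<close>

lemma Gc_iso:
  assumes p: "\<Psi> p = \<one>" and ann: "\<And>q. \<Psi> q = \<one> \<Longrightarrow> p dvd q"
  shows "G\<lparr>carrier := generate G {a, g}\<rparr> \<cong> Gc_presented (degree p) (poly.coeff p)"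
proof -
  let ?F = "free_group :: (Gc_gen \<times> bool) list set monoid"
  let ?R = "Gc_relators (degree p) (poly.coeff p)"
  let ?K = "normal_closure free_group ?R"
  let ?P = "Gc_presented (degree p) (poly.coeff p)"
  let ?H = "G\<lparr>carrier := generate G {a, g}\<rparr>"
  interpret F: group ?F by (rule group_free_group)
  interpret K: normal ?K ?F by (rule F.normal_normal_closure[OF Gc_relators_carrier])
  have P_eq: "?P = ?F Mod ?K" by (simp add: Gc_presented_def presented_group_def)
  interpret P: group ?P by (rule group_Gc_presented)
  interpret \<pi>: group_hom ?F ?P "(#>\<^bsub>?F\<^esub>) ?K"
    by unfold_locales (use K.r_coset_hom_Mod in \<open>simp add: P_eq\<close>)
  define \<alpha> where "\<alpha> = ?K #>\<^bsub>?F\<^esub> free_gen Alpha"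
  define \<beta> where "\<beta> = ?K #>\<^bsub>?F\<^esub> free_gen Beta"
  have \<alpha>\<beta>: "\<alpha> \<in> carrier ?P" "\<beta> \<in> carrier ?P" by (simp_all add: \<alpha>_def \<beta>_def)
  have "?R \<subseteq> ?K" unfolding normal_closure_def by blast
  then have "\<forall>r\<in>?R. ?K #>\<^bsub>?F\<^esub> r = \<one>\<^bsub>?P\<^esub>"
    using K.rcos_const[OF F.is_group] by (auto simp: P_eq)
  note rel = this[unfolded Gc_relators_trivial_iff[OF \<pi>.group_hom_axioms], folded \<alpha>_def \<beta>_def]
  interpret P: commuting_conjugates ?P \<beta> \<alpha>
    by unfold_locales (use rel \<alpha>\<beta> in auto)
  have \<Psi>P: "P.\<Psi> p = \<one>\<^bsub>?P\<^esub>" using rel P.foldr_conjugates[of p] by simp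
  have carrier_P: "carrier ?P = generate ?P {\<beta>, \<alpha>}"
  proof -
    have "UNIV = {Beta, Alpha}" using Gc_gen.exhaust by blast
    then have "range free_gen = {free_gen Beta, free_gen Alpha}" by (metis image_empty image_insert)
    then have "carrier ?F = generate ?F {free_gen Beta, free_gen Alpha}"
      using carrier_free_group_generate by metis
    then have "carrier ?P = (#>\<^bsub>?F\<^esub>) ?K ` generate ?F {free_gen Beta, free_gen Alpha}"
      by (metis P_eq carrier_FactGroup)
    also have "\<dots> = generate ?P ((#>\<^bsub>?F\<^esub>) ?K ` {free_gen Beta, free_gen Alpha})"
      by (rule \<pi>.generate_img[symmetric]) simp
    finally show ?thesis by (simp add: \<alpha>_def \<beta>_def)
  qed
  obtain e where e: "e \<in> hom ?F G" "\<And>x. e (free_gen x) = (case x of Alpha \<Rightarrow> g | Beta \<Rightarrow> a)"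
    by (rule free_group_universal[of "\<lambda>x. case x of Alpha \<Rightarrow> g | Beta \<Rightarrow> a"]) (auto split: Gc_gen.split)
  interpret e: group_hom ?F G e by unfold_locales (rule e(1))
  have "\<forall>r\<in>?R. e r = \<one>"
    unfolding Gc_relators_trivial_iff[OF e.group_hom_axioms]
    using conj_commute foldr_conjugates[of p] p by (simp add: e(2) del: upt_Suc foldr_map)
  then have "?K \<subseteq> kernel ?F G e"
    by (intro e.normal_closure_subset_kernel Gc_relators_carrier) auto
  from e.FactGroup_universal_kernel[OF K.normal_axioms this]
  obtain h where h: "h \<in> hom ?P G" "\<And>x. x \<in> carrier ?F \<Longrightarrow> h (?K #>\<^bsub>?F\<^esub> x) = e x"
    unfolding P_eq by metis
  interpret h: group_hom ?P G h by unfold_locales (rule h(1))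
  have h\<alpha>: "h \<alpha> = g" and h\<beta>: "h \<beta> = a" by (simp_all add: \<alpha>_def \<beta>_def h e)
  have img: "h ` carrier ?P = carrier ?H"
    using h.generate_img[of "{\<beta>, \<alpha>}"] \<alpha>\<beta> by (simp add: carrier_P[symmetric] h\<alpha> h\<beta>)
  have inj: "h x = \<one> \<Longrightarrow> x = \<one>\<^bsub>?P\<^esub>" if x: "x \<in> carrier ?P" for x
  proof -
    assume hx: "h x = \<one>"
    obtain f k where fk: "x = P.\<Phi> f \<otimes>\<^bsub>?P\<^esub> \<alpha> [^]\<^bsub>?P\<^esub> (k::int)" and fin: "finite {i. f i \<noteq> 0}"
      using x unfolding carrier_P P.generate_normal_form by blast
    have comm: "commuting_conjugates G (h \<beta>) (h \<alpha>)"
      unfolding h\<alpha> h\<beta> by (rule commuting_conjugates_axioms)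
    have "h (P.\<Phi> f) = \<Phi> f"
      using P.\<Phi>_hom[OF h.group_hom_axioms comm] by (simp add: h\<alpha> h\<beta>)
    then have "\<Phi> f \<otimes> g [^] k = \<one>"
      using hx \<alpha>\<beta> by (simp add: fk h.hom_int_pow h\<alpha>)
    then have k: "k = 0" "\<Phi> f = \<one>" by (rule normal_form_eq_one)+
    \<comment> \<open>The Laurent relation \<open>f\<close> is shifted to a polynomial
      \<open>q\<close>, to which the hypothesis on annihilators applies.\<close>
    obtain l q where q: "f = (\<lambda>i. poly_fun q (i + l))" "\<Phi> f = conj_by (- l) (\<Psi> q)"
      by (rule \<Phi>_poly[OF fin])
    have "\<Psi> q = conj_by l (conj_by (- l) (\<Psi> q))" by (simp add: conj_by_conj_by)
    also have "\<dots> = \<one>" unfolding q(2)[symmetric] k(2) by simp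
    finally obtain r where "q = r * p" using ann by (metis dvd_def mult.commute)
    then have "P.\<Psi> q = \<one>\<^bsub>?P\<^esub>" using P.\<Psi>_mult[OF \<Psi>P] by simp
    then have "P.\<Phi> f = \<one>\<^bsub>?P\<^esub>"
      using P.\<Phi>_shift[of "poly_fun q" l] q(1) by (simp add: P.\<Psi>_def)
    then show "x = \<one>\<^bsub>?P\<^esub>" using fk k by simp
  qed
  interpret H: group ?H by (intro subgroup_imp_group generate_is_subgroup) simp
  interpret hH: group_hom ?P ?H h
    by unfold_locales (use img in \<open>auto intro!: homI\<close>)
  have "h \<in> iso ?P ?H"
    unfolding hH.iso_iff using img inj by simp
  then show ?thesis using P.iso_sym is_isoI by blast
qed

end

section \<open>Contents and primitive polynomials\<close>

lemma content_eq_Gcd_coeffs: "p \<noteq> 0 \<Longrightarrow> content p = Gcd (poly.coeff p ` {0..degree p})"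
  for p :: "int poly"
proof -
  assume "p \<noteq> 0"
  then have "set (coeffs p) = poly.coeff p ` {0..degree p}"
    by (simp add: coeffs_def atLeastLessThanSuc_atLeastAtMost del: upt_Suc)
  then show ?thesis by (simp add: content_def Gcd_fin_eq_Gcd)
qed

text \<open>By Gauss's lemma contents are multiplicative. As \<open>p\<close> is primitive,
  \<open>c\<close> divides the content of the cofactor \<open>r\<close> and can be
  cancelled.\<close>

lemma primitive_dvd_smultD:
  fixes p q :: "int poly"
  assumes "content p = 1" "p dvd smult c q" "c \<noteq> 0"
  shows "p dvd q"
proof -
  obtain r where r: "smult c q = p * r" using assms(2) by (elim dvdE)
  have "c dvd content (smult c q)" by simp
  then have "c dvd content r" using assms(1) by (simp only: r content_mult mult_1)
  then have "[:c:] dvd r" by (simp add: const_poly_dvd_iff_dvd_content)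
  then obtain r' where "r = [:c:] * r'" by (elim dvdE)
  then have "smult c q = smult c (p * r')" using r by simp
  then have "q = p * r'" using assms(3) by (simp add: poly_eq_iff)
  then show ?thesis by simp
qed

section \<open>Subgroups of finite index and virtual commutativity\<close>

context group
begin

text \<open>Among finitely many cosets, two different powers of \<open>x\<close> share one, and
  their quotient lies in \<open>A\<close>.\<close>

lemma finite_index_pow:
  assumes A: "subgroup A G" and fin: "finite (rcosets A)" and x: "x \<in> carrier G"
  obtains n where "n > (0::nat)" "x [^] n \<in> A"
proof -
  have "range (\<lambda>n::nat. A #> x [^] n) \<subseteq> rcosets A"
    using x by (auto simp: RCOSETS_def)
  then have "finite (range (\<lambda>n::nat. A #> x [^] n))" using fin by (rule finite_subset)
  then have "\<not> inj (\<lambda>n::nat. A #> x [^] n)" using range_inj_infinite by blast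
  then obtain k l :: nat where kl: "k \<noteq> l" "A #> x [^] k = A #> x [^] l"
    by (auto simp: inj_def)
  define i j where "i = min k l" and "j = max k l"
  then have ij: "i < j" "A #> x [^] i = A #> x [^] j"
    using kl by (auto simp: min_def max_def)
  have "x [^] j \<in> A #> x [^] i" using ij x rcos_self A by simp
  then have "x [^] j \<otimes> inv (x [^] i) \<in> A"
    using x by (intro subgroup.rcos_module_imp[OF A is_group]) auto
  also have "x [^] j = x [^] (j - i) \<otimes> x [^] i" using ij x by (simp add: nat_pow_mult)
  finally have "x [^] (j - i) \<in> A" using x by (simp add: m_assoc)
  then show thesis using ij by (intro that[of "j - i"]) auto
qed

lemma finitely_generated_generate:
  assumes "finite S" "S \<subseteq> carrier G"
  shows "finitely_generated (G\<lparr>carrier := generate G S\<rparr>)"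
  unfolding finitely_generated_def
  using generate_consistent[OF _ generate_is_subgroup[OF assms(2)], of S] assms
  by (intro exI[of _ S]) (auto intro: generate.incl)

end

context commuting_conjugates
begin

text \<open>An abelian subgroup of finite index would contain positive powers of \<open>a\<close>
  and of \<open>g\<close>; these would commute, against the freeness of the pair formed by that
  power of \<open>a\<close> and \<open>g\<close>.\<close>

lemma not_virtually_abelian:
  assumes free: "\<And>d::nat. d > 0 \<Longrightarrow> free_conjugates G (a [^] d) g"
  shows "\<not> virtually_abelian (G\<lparr>carrier := generate G {a, g}\<rparr>)" (is "\<not> virtually_abelian ?H")
proof
  assume "virtually_abelian ?H"
  then obtain A where A: "subgroup A ?H" "finite (rcosets\<^bsub>?H\<^esub> A)" "comm_group (?H\<lparr>carrier := A\<rparr>)"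
    by (auto simp: virtually_abelian_def)
  have sub: "subgroup (generate G {a, g}) G" by (rule generate_is_subgroup) simp
  interpret H: group ?H by (rule subgroup_imp_group[OF sub])
  obtain d where d: "d > (0::nat)" "a [^]\<^bsub>?H\<^esub> d \<in> A"
    by (rule H.finite_index_pow[OF A(1,2), of a]) (auto intro: generate.incl)
  obtain n where n: "n > (0::nat)" "g [^]\<^bsub>?H\<^esub> n \<in> A"
    by (rule H.finite_index_pow[OF A(1,2), of g]) (auto intro: generate.incl)
  have "g [^] n \<otimes> a [^] d = a [^] d \<otimes> g [^] n"
    using comm_groupE(4)[OF A(3)] n(2) d(2) by (simp flip: nat_pow_consistent)
  then show False using free_conjugates.not_commute[OF free[OF d(1)] n(1)] by simp
qed

end

section \<open>Free pairs with torsion, with a polynomial relation, or with neither\<close>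

context free_conjugates
begin

text \<open>If a power of \<open>g\<close> fixes \<open>a [^] p\<close>, then \<open>a\<close> and
  its conjugate by that power differ by an element \<open>u\<close> with trivial \<open>p\<close>-th
  power. Were \<open>u\<close> also fixed by a positive power of \<open>g\<close>, the orbit of
  \<open>a\<close> would return to \<open>a\<close>.\<close>

lemma torsion_witness:
  assumes p: "p > (0::nat)" and nf: "\<not> free_conjugates G (a [^] p) g"
  obtains u where "u \<in> carrier G" "u [^] p = \<one>" "free_conjugates G u g"
proof (rule ccontr)
  assume contr: "\<not> thesis"
  note witness = that
  have fixed: "\<exists>n>0. conj_by (int n) u = u"
    if u: "u \<in> N" and not_free: "\<not> free_conjugates G u g" for u
  proof -
    interpret u: commuting_conjugates G u g by (rule commuting_conjugates_N[OF u])
    obtain n where "n > (0::nat)" "g [^] n \<otimes> u = u \<otimes> g [^] n"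
      using not_free u.commuting_conjugates_axioms
      by (auto simp: free_conjugates_def free_conjugates_axioms_def)
    then show ?thesis using conj_by_eq_iff[of u "int n"] N_carrier[OF u] by (auto simp: int_pow_int)
  qed
  have fixed_mult: "conj_by (i * int k) x = x" if "x \<in> carrier G" "conj_by i x = x" for i k x
  proof (induction k)
    case (Suc k)
    have "conj_by (i * int (Suc k)) x = conj_by (i * int k) (conj_by i x)"
      using that(1) by (simp add: conj_by_conj_by algebra_simps)
    then show ?case using Suc that by simp
  qed (use that in simp)
  obtain m where m: "m > 0" "conj_by (int m) (a [^] p) = a [^] p"
    using fixed[OF N_nat_pow[OF a_N] nf] by blast
  define u where "u = inv a \<otimes> b (int m)"
  have u: "u \<in> N" "u \<in> carrier G" by (simp_all add: u_def N_mult N_inv)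
  have pow_eq_1: "(inv a \<otimes> b (int M)) [^] p = \<one>" if "conj_by (int M) (a [^] p) = a [^] p" for M
  proof -
    have "(inv a \<otimes> b (int M)) [^] p = inv a [^] p \<otimes> b (int M) [^] p"
      using NG.nat_pow_distrib[of "inv a" "b (int M)" p] by (simp add: N_inv flip: nat_pow_consistent)
    also have "\<dots> = inv (a [^] p) \<otimes> conj_by (int M) (a [^] p)"
      by (simp add: b_def conj_by_pow nat_pow_inv)
    finally show ?thesis by (simp add: that)
  qed
  have "\<not> free_conjugates G u g"
    using contr witness[OF u(2)] pow_eq_1[OF m(2)] by (auto simp: u_def)
  then obtain n where n: "n > 0" "conj_by (int n) u = u" using fixed u by blast
  \<comment> \<open>A common multiple, so that \<open>g [^] M\<close> fixes both \<open>u\<close>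
    and \<open>a [^] p\<close>.\<close>
  define M where "M = m * n"
  have M: "M > 0" "conj_by (int M) u = u" "conj_by (int M) (a [^] p) = a [^] p"
    using m n fixed_mult[OF u(2) n(2), of m] fixed_mult[OF _ m(2), of n]
    by (simp_all add: M_def mult.commute)
  define w where "w = inv a \<otimes> b (int M)"
  have w: "w \<in> N" "w \<in> carrier G" by (simp_all add: w_def N_mult N_inv)
  have bm: "b (int m) = a \<otimes> u" by (simp add: u_def)
  \<comment> \<open>Since \<open>b (int m) = a \<otimes> u\<close> and \<open>u\<close> is fixed by
    \<open>g [^] M\<close>, conjugating \<open>w\<close> by \<open>g [^] m\<close> amounts to
    conjugating it by \<open>u\<close>, which has no effect in the abelian group
    \<open>N\<close>.\<close>
  have "conj_by (int m) w = inv (b (int m)) \<otimes> conj_by (int M) (b (int m))"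
    by (simp add: w_def conj_by_mult conj_by_inv conj_by_b add.commute flip: b_def)
  also have "\<dots> = inv (a \<otimes> u) \<otimes> (b (int M) \<otimes> u)"
    unfolding bm using u by (simp add: conj_by_mult M flip: b_def)
  also have "\<dots> = inv u \<otimes> (w \<otimes> u)"
    using u by (simp add: w_def inv_mult_group m_assoc)
  also have "w \<otimes> u = u \<otimes> w" using u w by (intro N_commute)
  finally have "conj_by (int m) w = w" using u w by simp
  then have cw: "conj_by (int M) w = w" using fixed_mult[OF w(2), of "int m" n] by (simp add: M_def)
  have bM: "b (int M) = a \<otimes> w" by (simp add: w_def)
  \<comment> \<open>Along multiples of \<open>M\<close> the orbit of \<open>a\<close> is a
    progression with constant ratio \<open>w\<close>. As \<open>w [^] p = \<one>\<close>, it returns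
    to \<open>a\<close> at \<open>k = p\<close>.\<close>
  have "b (int M * int k) = a \<otimes> w [^] k" for k
  proof (induction k)
    case (Suc k)
    have "b (int M * int (Suc k)) = conj_by (int M) (b (int M * int k))"
      by (simp add: conj_by_b algebra_simps)
    also have "\<dots> = b (int M) \<otimes> w [^] k"
      using w by (simp add: Suc conj_by_mult conj_by_pow cw flip: b_def)
    also have "\<dots> = a \<otimes> w [^] Suc k"
      using w nat_pow_Suc2[of w k] by (simp add: bM m_assoc)
    finally show ?case .
  qed (simp add: b_def)
  from this[of p] have "b (int M * int p) = a"
    using pow_eq_1[OF M(3)] by (simp add: w_def)
  then show False using b_neq_a[of "int M * int p"] M(1) p by simp
qed

text \<open>The top coefficient of a nontrivial relation is invertible modulo \<open>p\<close>, so
  the top conjugate lies in the finite subgroup generated by the lower ones in the support range.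
  Conjugation by \<open>g\<close> then keeps infinitely many distinct conjugates inside that finite
  subgroup.\<close>

lemma prime_torsion_wreath_iso:
  assumes p: "Factorial_Ring.prime (p::nat)" "a [^] p = \<one>"
  shows "G\<lparr>carrier := generate G {a, g}\<rparr> \<cong> wreath_product (integer_mod_group p) integer_group"
proof (rule wreath_iso[OF p(2)], rule ccontr)
  fix f :: "int \<Rightarrow> int"
  assume fin: "finite {i. f i \<noteq> 0}" and mod: "\<And>i. f i \<in> carrier (integer_mod_group p)"
    and \<Phi>f: "\<Phi> f = \<one>" and "f \<noteq> (\<lambda>_. 0)"
  then have ne: "{i. f i \<noteq> 0} \<noteq> {}" by auto
  have p0: "p > 0" using p(1) by (simp add: prime_gt_0_nat)
  define l u where "l = Min {i. f i \<noteq> 0}" and "u = Max {i. f i \<noteq> 0}"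
  \<comment> \<open>The interval excludes the top index \<open>u\<close>, whose conjugate is to be
    expressed by the others.\<close>
  let ?S = "generate G (b ` {l..<u})"
  have sub: "subgroup ?S G" by (rule generate_is_subgroup) auto
  have fu: "f u \<noteq> 0" using Max_in[OF fin ne] by (simp add: u_def)
  have supp: "f i = 0" if "i < l \<or> i > u" for i
    using that Min_le[OF fin, of i] Max_ge[OF fin, of i]
    by (cases "f i = 0") (auto simp: l_def u_def)
  let ?r = "\<lambda>i. if i = u then 0 else f i"
  have "\<Phi> f = \<Phi> (\<lambda>i. ?r i + (if i = u then f u else 0))"
    by (rule arg_cong[of _ _ \<Phi>]) auto
  also have "\<dots> = \<Phi> ?r \<otimes> b u [^] f u"
    by (subst \<Phi>_add) (auto simp: \<Phi>_single intro: finite_subset[OF _ fin])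
  finally have "b u [^] f u \<otimes> \<Phi> ?r = \<one>"
    using \<Phi>f N_commute[of "\<Phi> ?r" "b u [^] f u"] by (simp add: N_pow)
  then have "inv (\<Phi> ?r) = b u [^] f u" by (rule inv_equality) simp_all
  moreover have "\<Phi> ?r \<in> ?S"
  proof (rule \<Phi>_generate, rule subsetI)
    fix i assume "i \<in> {i. ?r i \<noteq> 0}"
    then have "i \<noteq> u" "f i \<noteq> 0" by (auto split: if_splits)
    then show "i \<in> {l..<u}" using supp[of i] by force
  qed
  ultimately have bfu: "b u [^] f u \<in> ?S"
    using subgroup.m_inv_closed[OF sub] by metis
  have bS: "b u \<in> ?S"
  proof -
    have "0 < f u" "f u < int p"
      using mod[of u] fu p0 by (auto simp: carrier_integer_mod_group)
    then have "\<not> int p dvd f u" using zdvd_not_zless by blast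
    then have "coprime (f u) (int p)"
      using p(1) prime_imp_coprime[of "int p" "f u"] by (simp add: coprime_commute)
    then obtain x y where xy: "x * f u + y * int p = 1"
      by (metis coprime_iff_gcd_eq_1 bezout_int)
    have "b u [^] int p = \<one>" using p(2) by (simp add: b_def int_pow_int flip: conj_by_pow)
    then have "(b u [^] int p) [^] y = \<one>" by simp
    then have "b u = (b u [^] f u) [^] x"
      using xy int_pow_mult[of "b u" "f u * x" "int p * y"] by (simp add: int_pow_pow mult.commute)
    then show ?thesis using subgroup_int_pow_closed[OF sub bfu] by metis
  qed
  \<comment> \<open>Under conjugation by \<open>g\<close> only the last generator leaves the index
    range, and its image \<open>b u\<close> is in \<open>?S\<close> by \<open>bS\<close>.\<close>
  have S_closed: "conj_by 1 x \<in> ?S" if "x \<in> ?S" for x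
  proof -
    interpret c: group_hom G G "conj_by 1" by unfold_locales (rule conj_by_hom)
    have "conj_by 1 ` ?S = generate G (conj_by 1 ` b ` {l..<u})"
      by (rule c.generate_img[symmetric]) auto
    also have "\<dots> \<subseteq> ?S"
    proof (rule generate_subgroup_incl[OF _ sub], clarsimp simp: conj_by_b)
      fix i assume "l \<le> i" "i < u"
      then show "b (1 + i) \<in> ?S"
        using bS by (cases "1 + i = u") (auto intro: generate.incl)
    qed
    finally show ?thesis using that by blast
  qed
  have "b (u + int n) \<in> ?S" for n
  proof (induction n)
    case (Suc n)
    have "b (u + int (Suc n)) = conj_by 1 (b (u + int n))" by (simp add: conj_by_b algebra_simps)
    then show ?case using S_closed[OF Suc] by simp
  qed (use bS in simp)
  then have "range (\<lambda>n. b (u + int n)) \<subseteq> ?S" by blast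
  moreover have "finite ?S" by (rule finite_generate_powers[OF p0 p(2)]) simp
  ultimately have "finite (range (\<lambda>n. b (u + int n)))" by (rule finite_subset)
  moreover have "inj (\<lambda>n. b (u + int n))"
    by (rule injI) (auto dest: injD[OF inj_b])
  ultimately show False using range_inj_infinite by blast
qed

lemma nonfree_proper_Gc_group:
  assumes free: "\<And>d::nat. d > 0 \<Longrightarrow> free_conjugates G (a [^] d) g"
    and rel: "\<Psi> p0 = \<one>" "p0 \<noteq> 0"
  obtains d where "d > (0::nat)" "proper_Gc_group (G\<lparr>carrier := generate G {a [^] d, g}\<rparr>)"
proof -
  obtain p where p: "\<Psi> p = \<one>" "p \<noteq> 0" and min: "\<And>q. \<lbrakk>\<Psi> q = \<one>; q \<noteq> 0\<rbrakk> \<Longrightarrow> degree p \<le> degree q"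
    using ex_has_least_nat[of "\<lambda>p. \<Psi> p = \<one> \<and> p \<noteq> 0" p0 degree] rel by blast
  \<comment> \<open>The content is moved from the polynomial to the group element: \<open>p\<close>
    annihilates \<open>a\<close> exactly because its primitive part annihilates
    \<open>a [^] d\<close>.\<close>
  define d where "d = nat (content p)"
  define q where "q = primitive_part p"
  have "content p > 0"
    using p(2) by (metis abs_ge_zero content_eq_zero_iff normalize_content normalize_int_def order_less_le)
  then have d: "d > 0" "int d = content p" by (simp_all add: d_def)
  have pq: "p = smult (int d) q" by (simp add: d q_def)
  have q: "content q = 1" "q \<noteq> 0" "degree q = degree p" using p(2) by (auto simp: q_def)
  interpret d: free_conjugates G "a [^] d" g by (rule free[OF d(1)])
  have d\<Psi>: "d.\<Psi> r = \<Psi> (smult (int d) r)" for r by (rule \<Psi>_pow)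
  have dq: "d.\<Psi> q = \<one>" using p by (simp add: d\<Psi> flip: pq)
  have ann: "q dvd r" if "d.\<Psi> r = \<one>" for r
  proof -
    let ?r = "smult (int d) r"
    \<comment> \<open>Pseudo-division replaces division, as leading coefficients need not be
      invertible. The remainder also annihilates \<open>a\<close>, so it vanishes by the minimality
      of the degree of \<open>p\<close>.\<close>
    obtain c s where cs: "c \<noteq> 0" "smult c ?r = p * s + pseudo_mod ?r p"
      using pseudo_mod(1)[OF p(2)] by blast
    have "\<Psi> (smult c ?r) = \<one>" using that by (simp only: \<Psi>_smult[of c]) (simp add: d\<Psi>)
    moreover have "\<Psi> (p * s) = \<one>" using \<Psi>_mult[OF p(1), of s] by (simp add: mult.commute)
    ultimately have "\<Psi> (pseudo_mod ?r p) = \<one>" using \<Psi>_add[of "p * s" "pseudo_mod ?r p"] cs by simp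
    then have "pseudo_mod ?r p = 0"
      using pseudo_mod(2)[OF p(2), of ?r] min by fastforce
    then have "smult (c * int d) r = q * smult (int d) s" using cs pq by simp
    then have "q dvd smult (c * int d) r" by (simp only: dvd_triv_left)
    then show ?thesis using primitive_dvd_smultD[OF q(1)] cs(1) d(1) by simp
  qed
  \<comment> \<open>A primitive constant is a unit, which would make \<open>a [^] d\<close>
    trivial.\<close>
  have "degree q \<noteq> 0"
  proof
    assume "degree q = 0"
    then obtain c where c: "q = [:c:]" by (rule degree_eq_zeroE)
    then have "is_unit c" using q(1) by simp
    then have "q dvd 1" by (simp add: c is_unit_const_poly_iff)
    then have "d.\<Psi> 1 = \<one>" using d.\<Psi>_mult[OF dq] by (metis dvdE mult.commute)
    then show False using d.not_commute[of 1] by (simp add: d.\<Psi>_1)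
  qed
  \<comment> \<open>Otherwise the indeterminate, which acts invertibly, could be cancelled, leaving
    a nonzero annihilating polynomial of smaller degree.\<close>
  moreover have "poly.coeff q 0 \<noteq> 0"
  proof
    assume "poly.coeff q 0 = 0"
    then obtain r where r: "q = pCons 0 r" by (metis coeff_pCons_0 pCons_cases)
    then have "d.conj_by 1 (d.\<Psi> r) = \<one>" using dq by (simp add: d.\<Psi>_pCons_0)
    then have "d.conj_by (- 1) (d.conj_by 1 (d.\<Psi> r)) = \<one>" by simp
    then have "d.\<Psi> r = \<one>" by (simp add: d.conj_by_conj_by)
    then have "q dvd r" by (rule ann)
    moreover have "r \<noteq> 0" using r q by auto
    ultimately show False using dvd_imp_degree_le[of q r] r by simp
  qed
  ultimately have "Gc_admissible (degree q) (poly.coeff q)"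
    using q(1,2) content_eq_Gcd_coeffs[OF q(2)] by (simp add: Gc_admissible_def Suc_le_eq)
  moreover have "group (G\<lparr>carrier := generate G {a [^] d, g}\<rparr>)"
    by (intro subgroup_imp_group generate_is_subgroup) simp
  moreover have "\<not> virtually_abelian (G\<lparr>carrier := generate G {a [^] d, g}\<rparr>)"
    by (rule d.not_virtually_abelian) (simp add: nat_pow_pow free d)
  ultimately have "proper_Gc_group (G\<lparr>carrier := generate G {a [^] d, g}\<rparr>)"
    using d.Gc_iso[OF dq ann] unfolding proper_Gc_group_def Gc_group_def by blast
  then show thesis using that d by blast
qed

text \<open>A Laurent relation can be shifted to a polynomial relation, so the hypothesis excludes
  both kinds; the criterion \<open>wreath_iso\<close> then applies with
  \<open>n = 0\<close>.\<close>

lemma free_wreath_iso: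
  assumes "\<And>p. \<Psi> p = \<one> \<Longrightarrow> p = 0"
  shows "G\<lparr>carrier := generate G {a, g}\<rparr> \<cong> wreath_product integer_group integer_group"
proof -
  have "f = (\<lambda>_. 0)" if fin: "finite {i. f i \<noteq> 0}" and f: "\<Phi> f = \<one>" for f
  proof -
    obtain k p where p: "f = (\<lambda>i. poly_fun p (i + k))" "\<Phi> f = conj_by (- k) (\<Psi> p)"
      by (rule \<Phi>_poly[OF fin])
    have "\<Psi> p = conj_by k (conj_by (- k) (\<Psi> p))" by (simp add: conj_by_conj_by)
    then have "p = 0" unfolding p(2)[symmetric] f by (intro assms) simp
    then show ?thesis using p(1) by auto
  qed
  then show ?thesis using wreath_iso[of 0] by (simp add: integer_mod_group_def)
qed

end

text \<open>Induction on the prime factors of \<open>d\<close>: if freeness were lost on passing to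
  a \<open>p\<close>-th power, \<open>torsion_witness\<close> would supply an excluded
  element.\<close>

lemma (in group) free_conjugates_pow:
  assumes a: "free_conjugates G a g"
    and no_torsion: "\<And>u p. \<lbrakk>u \<in> carrier G; Factorial_Ring.prime (p::nat); u [^] p = \<one>\<rbrakk>
      \<Longrightarrow> \<not> free_conjugates G u g"
    and "d > (0::nat)"
  shows "free_conjugates G (a [^] d) g"
  using \<open>d > 0\<close>
proof (induction d rule: prime_divisors_induct)
  case zero
  then show ?case by simp
next
  case (unit d)
  interpret a: free_conjugates G a g by fact
  from unit show ?case using a by simp
next
  case (factor p d)
  interpret a: free_conjugates G a g by fact
  have "free_conjugates G (a [^] d) g" using factor by simp
  then interpret d: free_conjugates G "a [^] d" g .
  have "free_conjugates G ((a [^] d) [^] p) g"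
  proof (rule ccontr)
    assume "\<not> free_conjugates G ((a [^] d) [^] p) g"
    then obtain u where "u \<in> carrier G" "u [^] p = \<one>" "free_conjugates G u g"
      by (rule d.torsion_witness[OF prime_gt_0_nat[OF factor.hyps(1)]])
    then show False using no_torsion[OF _ factor.hyps(1)] by simp
  qed
  then show ?case by (simp add: nat_pow_pow mult.commute)
qed

theorem theorem3p3:
  fixes G :: "('a, 'b) monoid_scheme"
  assumes "group G"
    and "finitely_generated G"
    and "metabelian G"
    and "\<not> virtually_abelian G"
  shows "\<exists>H. subgroup H G \<and> finitely_generated (G\<lparr>carrier := H\<rparr>) \<and>
    (G\<lparr>carrier := H\<rparr> \<cong> wreath_product integer_group integer_group \<or>
     (\<exists>p :: nat. Factorial_Ring.prime p \<and>
        G\<lparr>carrier := H\<rparr> \<cong> wreath_product (integer_mod_group p) integer_group) \<or>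
     proper_Gc_group (G\<lparr>carrier := H\<rparr>))"
proof -
  interpret group G by fact
  have gen: "subgroup (generate G {x, y}) G \<and> finitely_generated (G\<lparr>carrier := generate G {x, y}\<rparr>)"
    if "x \<in> carrier G" "y \<in> carrier G" for x y
    using that by (simp add: generate_is_subgroup finitely_generated_generate)
  obtain a g where ag: "a \<in> carrier G" "g \<in> carrier G"
    "\<And>i::int. a \<otimes>\<^bsub>G\<^esub> grp_conjugate G a (g [^]\<^bsub>G\<^esub> i) = grp_conjugate G a (g [^]\<^bsub>G\<^esub> i) \<otimes>\<^bsub>G\<^esub> a"
    "\<And>m::nat. m > 0 \<Longrightarrow> g [^]\<^bsub>G\<^esub> m \<otimes>\<^bsub>G\<^esub> a \<noteq> a \<otimes>\<^bsub>G\<^esub> g [^]\<^bsub>G\<^esub> m"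
    using metabelian_not_virtually_abelian_pair assms by blast
  interpret free_conjugates G a g by unfold_locales (use ag in auto)
  show ?thesis
  \<comment> \<open>The element \<open>g\<close> stays fixed. A \<open>u\<close> as in the first
    case has order exactly \<open>p\<close>, because the identity commutes with \<open>g\<close>. In
    the second case all positive powers of \<open>a\<close> form free pairs with
    \<open>g\<close>.\<close>
  proof (cases "\<exists>u p. u \<in> carrier G \<and> Factorial_Ring.prime (p::nat) \<and> u [^]\<^bsub>G\<^esub> p = \<one>\<^bsub>G\<^esub> \<and> free_conjugates G u g")
    case True
    then obtain u p where u: "u \<in> carrier G" "Factorial_Ring.prime (p::nat)" "u [^]\<^bsub>G\<^esub> p = \<one>\<^bsub>G\<^esub>"
      "free_conjugates G u g" by blast
    show ?thesis
      using free_conjugates.prime_torsion_wreath_iso[OF u(4,2,3)] gen[OF u(1) ag(2)] u(2) by blast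
  next
    case False
    then have free: "free_conjugates G (a [^]\<^bsub>G\<^esub> d) g" if "d > 0" for d :: nat
      using free_conjugates_pow[OF free_conjugates_axioms] that by blast
    show ?thesis
    proof (cases "\<exists>p. \<Psi> p = \<one>\<^bsub>G\<^esub> \<and> p \<noteq> 0")
      case True
      then obtain p where "\<Psi> p = \<one>\<^bsub>G\<^esub>" "p \<noteq> 0" by blast
      then obtain d where "proper_Gc_group (G\<lparr>carrier := generate G {a [^]\<^bsub>G\<^esub> (d::nat), g}\<rparr>)"
        using nonfree_proper_Gc_group[OF free] by blast
      then show ?thesis using gen[of "a [^]\<^bsub>G\<^esub> d" g] ag by blast
    next
      case False
      then show ?thesis using free_wreath_iso gen[OF ag(1,2)] by blast
    qed
  qed
qed

end
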